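(* Let $p$ be a prime, $n\ge 2$ an integer, and $m=(m_1,\dots,m_n)$ a tuple of integers with $m_j\ge 1$. Let $A$ be the pseudo-differential operator $$(A\phi)(x)=F^{-1}\big[\mathcal{A}(\xi)\,F[\phi](\xi)\big](x),\qquad \phi\in\Phi(\mathbb{Q}_p^n),$$ with symbol $\mathcal{A}\in\mathcal{E}(\mathbb{Q}_p^n\setminus\{0\})$. Let $\gamma\in\mathbb{Z}$, $s\in J_{p;m}^n$, $a\in I_p^n$. Then the $n$-dimensional $p$-adic wavelet $$\Theta_{\gamma s a}^{(m)}(x)=p^{-n\gamma/2}\,\chi_p\big(s\cdot(p^{\gamma}x-a)\big)\,\Omega\big(|p^{\gamma}x-a|_p\big),\qquad x\in\mathbb{Q}_p^n,$$ is an eigenfunction of $A$ if and only if $$\mathcal{A}\big(p^{\gamma}(-s+\eta)\big)=\mathcal{A}\big(-p^{\gamma}s\big)\qquad\text{for all }\eta\in\mathbb{Z}_p^n.$$ In this case the eigenvalue is $\lambda=\mathcal{A}(-p^{\gamma}s)$, i.e. $A\Theta_{\gamma s a}^{(m)}=\mathcal{A}(-p^{\gamma}s)\,\Theta_{\gamma s a}^{(m)}$.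
   Context: For $x\in\mathbb{Q}_p^n$, $|x|_p=\max_{1\le j\le n}|x_j|_p$. Haar measure $d^nx$ on $\mathbb{Q}_p^n$ is normalized so that $\mathbb{Z}_p^n$ has measure $1$. For $\xi,x\in\mathbb{Q}_p^n$, $\xi\cdot x=\sum_j\xi_jx_j$ and $\chi_p(\xi\cdot x)=e^{2\pi i\sum_{j=1}^n\{\xi_jx_j\}_p}$, where $\{y\}_p$ is the fractional part of $y\in\mathbb{Q}_p$: $\{y\}_p=0$ if $y\in\mathbb{Z}_p$, and $\{y\}_p=p^{\gamma}(y_0+y_1p+\cdots+y_{|\gamma|-1}p^{|\gamma|-1})$ if $y=p^{\gamma}(y_0+y_1p+\cdots)$ with $\gamma<0$, $0\le y_j\le p-1$, $y_0\neq0$. $\Omega(t)=1$ for $0\le t\le 1$ and $\Omega(t)=0$ for $t>1$. $I_p=\{p^{-k}(a_0+a_1p+\cdots+a_{k-1}p^{k-1}) : k\in\mathbb{N},\ a_j\in\{0,\dots,p-1\}\}$ (representatives of $\mathbb{Q}_p/\mathbb{Z}_p$; $\mathbb{N}$ is the set of positive integers) and $I_p^n=I_p\times\cdots\times I_p$. For an integer $k\ge1$, $J_{p;k}=\{p^{-k}(s_0+s_1p+\cdots+s_{k-1}p^{k-1}) : s_j\in\{0,\dots,p-1\},\ s_0\neq 0\}$ and $J_{p;m}^n=J_{p;m_1}\times\cdots\times J_{p;m_n}$. $\mathcal{D}(\mathbb{Q}_p^n)$ is the space of locally constant, compactly supported functions $\mathbb{Q}_p^n\to\mathbb{C}$; $\mathcal{E}(\mathbb{Q}_p^n\setminus\{0\})$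 is the space of locally constant functions $\mathbb{Q}_p^n\setminus\{0\}\to\mathbb{C}$. The Fourier transform on $\mathcal{D}(\mathbb{Q}_p^n)$ is $F[\varphi](\xi)=\int_{\mathbb{Q}_p^n}\chi_p(\xi\cdot x)\varphi(x)\,d^nx$, with inverse $F^{-1}[\psi](x)=\int_{\mathbb{Q}_p^n}\chi_p(-x\cdot\xi)\psi(\xi)\,d^n\xi$. Let $\Psi(\mathbb{Q}_p^n)=\{\psi\in\mathcal{D}(\mathbb{Q}_p^n):\psi(0)=0\}$. The $p$-adic Lizorkin space of test functions is $\Phi(\mathbb{Q}_p^n)=\{F[\psi]:\psi\in\Psi(\mathbb{Q}_p^n)\}$, equivalently the set of $\phi\in\mathcal{D}(\mathbb{Q}_p^n)$ with $\int_{\mathbb{Q}_p^n}\phi\,d^nx=0$. For $\phi\in\Phi(\mathbb{Q}_p^n)$, $F[\phi]$ vanishes in a neighbourhood of $0$, and $\mathcal{A}F[\phi]$ is taken to be $0$ at $\xi=0$. The wavelets $\Theta_{\gamma s a}^{(m)}$ belong to $\Phi(\mathbb{Q}_p^n)$. *)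

theory Defs
  imports "HOL-Analysis.Analysis" "Berlekamp_Zassenhaus.Finite_Field"
begin

section \<open>The \<open>p\<close>-adic absolute value on the rationals\<close>

definition padic_abs :: "nat \<Rightarrow> rat \<Rightarrow> real" where
  "padic_abs p q = (if q = 0 then 0
     else real p powi (int (multiplicity (int p) (snd (quotient_of q)))
                       - int (multiplicity (int p) (fst (quotient_of q)))))"

lemma padic_abs_Fract:
  assumes "prime p" "a \<noteq> 0" "b \<noteq> 0"
  shows "padic_abs p (Rat.Fract a b)
         = real p powi (int (multiplicity (int p) b) - int (multiplicity (int p) a))"
proof -
  obtain c d where cd: "quotient_of (Rat.Fract a b) = (c, d)" by fastforce
  have d: "d > 0" using quotient_of_denom_pos[OF cd] .
  have eq: "Rat.Fract a b = Rat.Fract c d"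
    using quotient_of_div[OF cd] by (simp add: Fract_of_int_quotient)
  then have e: "a * d = c * b" using assms d by (simp add: eq_rat)
  then have c: "c \<noteq> 0" using assms d by auto
  have p: "prime_elem (int p)" using assms by simp
  have "multiplicity (int p) a + multiplicity (int p) d
      = multiplicity (int p) c + multiplicity (int p) b"
    using e p assms(2,3) c d
    by (metis less_irrefl prime_elem_multiplicity_mult_distrib)
  then have "int (multiplicity (int p) b) - int (multiplicity (int p) a)
      = int (multiplicity (int p) d) - int (multiplicity (int p) c)" by linarith
  moreover have "Rat.Fract a b \<noteq> 0" using assms by (simp add: Zero_rat_def eq_rat)
  ultimately show ?thesis by (simp add: padic_abs_def cd)
qed

lemma padic_abs_0 [simp]: "padic_abs p 0 = 0"
  by (simp add: padic_abs_def)

lemma padic_abs_pos: "prime p \<Longrightarrow> q \<noteq> 0 \<Longrightarrow> padic_abs p q > 0"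
  by (simp add: padic_abs_def prime_gt_0_nat)

lemma padic_abs_nonneg: "prime p \<Longrightarrow> padic_abs p q \<ge> 0"
  using padic_abs_pos[of p q] by (cases "q = 0") auto

lemma padic_abs_eq_0_iff: "prime p \<Longrightarrow> padic_abs p q = 0 \<longleftrightarrow> q = 0"
  using padic_abs_pos[of p q] by (cases "q = 0") auto

lemma padic_abs_1: "prime p \<Longrightarrow> padic_abs p 1 = 1"
  using padic_abs_Fract[of p 1 1] by (simp add: One_rat_def)

lemma padic_abs_mult:
  assumes "prime p"
  shows "padic_abs p (x * y) = padic_abs p x * padic_abs p y"
proof (cases "x = 0 \<or> y = 0")
  case False
  obtain a b where x: "x = Rat.Fract a b" "b > 0" by (cases x) auto
  obtain c d where y: "y = Rat.Fract c d" "d > 0" by (cases y) auto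
  have nz: "a \<noteq> 0" "c \<noteq> 0" using False x y by (auto simp: rat_number_collapse)
  have p: "prime_elem (int p)" using assms by simp
  have "padic_abs p (x * y) = padic_abs p (Rat.Fract (a * c) (b * d))" by (simp add: x y)
  also have "\<dots> = real p powi ((int (multiplicity (int p) b) - int (multiplicity (int p) a))
                 + (int (multiplicity (int p) d) - int (multiplicity (int p) c)))"
    using nz x y p assms
    by (subst padic_abs_Fract) (auto simp: prime_elem_multiplicity_mult_distrib algebra_simps)
  also have "\<dots> = padic_abs p x * padic_abs p y"
    using nz x y assms prime_gt_0_nat[OF assms]
    by (simp add: padic_abs_Fract power_int_add)
  finally show ?thesis .
qed auto

lemma padic_abs_minus:
  assumes "prime p" shows "padic_abs p (- x) = padic_abs p x"
proof -
  have "multiplicity (int p) (- 1) = 0"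
    using assms by (intro not_dvd_imp_multiplicity_0) auto
  then have "padic_abs p (- 1) = 1"
    using padic_abs_Fract[OF assms, of "-1" 1] by (simp add: rat_number_collapse)
  then show ?thesis using padic_abs_mult[OF assms, of "-1" x] by simp
qed

lemma padic_abs_diff_commute: "prime p \<Longrightarrow> padic_abs p (x - y) = padic_abs p (y - x)"
  using padic_abs_minus[of p "x - y"] by simp

lemma padic_abs_inverse:
  assumes "prime p" shows "padic_abs p (inverse x) = inverse (padic_abs p x)"
proof (cases "x = 0")
  case False
  then have "padic_abs p (inverse x) * padic_abs p x = 1"
    using padic_abs_mult[OF assms, of "inverse x" x] padic_abs_1[OF assms] by simp
  then show ?thesis by (metis inverse_unique mult.commute)
qed auto

lemma padic_abs_ultrametric:
  assumes p: "prime p"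
  shows "padic_abs p (x + y) \<le> max (padic_abs p x) (padic_abs p y)"
proof (cases "x = 0 \<or> y = 0 \<or> x + y = 0")
  case True
  then show ?thesis using padic_abs_nonneg[OF p] by (auto simp: le_max_iff_disj)
next
  case False
  obtain a b where x: "x = Rat.Fract a b" "b > 0" by (cases x) auto
  obtain c d where y: "y = Rat.Fract c d" "d > 0" by (cases y) auto
  have x': "x = Rat.Fract (a * d) (b * d)" and y': "y = Rat.Fract (c * b) (b * d)"
    using x y by (auto simp: eq_rat)
  have xy: "x + y = Rat.Fract (a * d + c * b) (b * d)" using x y by simp
  define u v where "u = a * d" and "v = c * b"
  have nz: "u \<noteq> 0" "v \<noteq> 0" "u + v \<noteq> 0" "b * d \<noteq> 0"
    using False x' y' xy x(2) y(2) unfolding u_def v_def by (auto simp: rat_number_collapse)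
  define k where "k = min (multiplicity (int p) u) (multiplicity (int p) v)"
  have "int p ^ k dvd u" "int p ^ k dvd v"
    unfolding k_def by (auto intro: multiplicity_dvd')
  then have "int p ^ k dvd u + v" by simp
  then have "k \<le> multiplicity (int p) (u + v)"
    using nz p by (intro multiplicity_geI) (auto simp: prime_gt_1_nat)
  then have "multiplicity (int p) u \<le> multiplicity (int p) (u + v)
      \<or> multiplicity (int p) v \<le> multiplicity (int p) (u + v)"
    unfolding k_def by linarith
  moreover have "real p \<ge> 1" using prime_gt_1_nat[OF p] by simp
  ultimately show ?thesis
    using nz p xy x' y' unfolding u_def[symmetric] v_def[symmetric]
    by (auto simp: padic_abs_Fract le_max_iff_disj intro!: power_int_increasing)
qed

section \<open>The field \<open>\<rat>\<^sub>p\<close> as the completion of \<open>\<rat>\<close>\<close>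

definition padic_null :: "nat \<Rightarrow> (nat \<Rightarrow> rat) \<Rightarrow> bool" where
  "padic_null p X \<longleftrightarrow> (\<forall>r>0. \<exists>k. \<forall>n\<ge>k. padic_abs p (X n) < r)"

definition padic_Cauchy :: "nat \<Rightarrow> (nat \<Rightarrow> rat) \<Rightarrow> bool" where
  "padic_Cauchy p X \<longleftrightarrow> (\<forall>r>0. \<exists>k. \<forall>m\<ge>k. \<forall>n\<ge>k. padic_abs p (X m - X n) < r)"

context
  fixes p :: nat
  assumes p: "prime p"
begin

lemma padic_null_0: "padic_null p (\<lambda>n. 0)"
  by (simp add: padic_null_def)

lemma padic_null_minus: "padic_null p X \<Longrightarrow> padic_null p (\<lambda>n. - X n)"
  by (simp add: padic_null_def padic_abs_minus[OF p])

lemma padic_null_add: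
  assumes "padic_null p X" "padic_null p Y"
  shows "padic_null p (\<lambda>n. X n + Y n)"
  unfolding padic_null_def
proof (intro allI impI)
  fix r :: real assume r: "r > 0"
  obtain i j where "\<forall>n\<ge>i. padic_abs p (X n) < r" "\<forall>n\<ge>j. padic_abs p (Y n) < r"
    using assms r unfolding padic_null_def by metis
  then have "\<forall>n\<ge>max i j. padic_abs p (X n + Y n) < r"
    using le_less_trans[OF padic_abs_ultrametric[OF p]] by simp
  then show "\<exists>k. \<forall>n\<ge>k. padic_abs p (X n + Y n) < r" ..
qed

lemma padic_Cauchy_const: "padic_Cauchy p (\<lambda>n. c)"
  by (simp add: padic_Cauchy_def)

lemma padic_Cauchy_minus: "padic_Cauchy p X \<Longrightarrow> padic_Cauchy p (\<lambda>n. - X n)"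
  unfolding padic_Cauchy_def minus_diff_minus padic_abs_minus[OF p] .

lemma padic_Cauchy_add:
  assumes "padic_Cauchy p X" "padic_Cauchy p Y"
  shows "padic_Cauchy p (\<lambda>n. X n + Y n)"
  unfolding padic_Cauchy_def
proof (intro allI impI)
  fix r :: real assume r: "r > 0"
  obtain i j where ij: "\<forall>m\<ge>i. \<forall>n\<ge>i. padic_abs p (X m - X n) < r"
     "\<forall>m\<ge>j. \<forall>n\<ge>j. padic_abs p (Y m - Y n) < r"
    using assms r unfolding padic_Cauchy_def by metis
  have "\<forall>m\<ge>max i j. \<forall>n\<ge>max i j. padic_abs p ((X m + Y m) - (X n + Y n)) < r"
    unfolding add_diff_add using ij le_less_trans[OF padic_abs_ultrametric[OF p]] by simp
  then show "\<exists>k. \<forall>m\<ge>k. \<forall>n\<ge>k. padic_abs p ((X m + Y m) - (X n + Y n)) < r" ..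
qed

lemma padic_abs_eqI:
  assumes "padic_abs p (x - y) < padic_abs p y"
  shows "padic_abs p x = padic_abs p y"
proof (rule antisym)
  show "padic_abs p x \<le> padic_abs p y"
    using padic_abs_ultrametric[OF p, of "x - y" y] assms by simp
  show "padic_abs p y \<le> padic_abs p x"
    using padic_abs_ultrametric[OF p, of "y - x" x] assms padic_abs_diff_commute[OF p, of x y]
    by simp
qed

lemma padic_Cauchy_not_null:
  assumes X: "padic_Cauchy p X" "\<not> padic_null p X"
  obtains c k where "c > 0" "\<And>n. n \<ge> k \<Longrightarrow> padic_abs p (X n) = c"
proof -
  obtain r where r: "r > 0" "\<forall>k. \<exists>n\<ge>k. padic_abs p (X n) \<ge> r"
    using X(2) unfolding padic_null_def by (meson not_le)
  obtain k where k: "\<forall>m\<ge>k. \<forall>n\<ge>k. padic_abs p (X m - X n) < r"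
    using X(1) r(1) unfolding padic_Cauchy_def by blast
  obtain l where l: "l \<ge> k" "padic_abs p (X l) \<ge> r" using r(2) by blast
  show ?thesis
  proof (rule that)
    show "padic_abs p (X l) > 0" using l r by linarith
    show "padic_abs p (X n) = padic_abs p (X l)" if "n \<ge> k" for n
      using k l that by (intro padic_abs_eqI) (meson less_le_trans)
  qed
qed

lemma padic_Cauchy_bounded:
  assumes X: "padic_Cauchy p X"
  obtains b k where "b > 0" "\<And>n. n \<ge> k \<Longrightarrow> padic_abs p (X n) \<le> b"
proof (cases "padic_null p X")
  case True
  then show ?thesis
    using that[of 1] unfolding padic_null_def by (metis less_imp_le zero_less_one)
next
  case False
  then show ?thesis using padic_Cauchy_not_null[OF X False] that by (metis order_refl)
qed

lemma padic_null_mult: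
  assumes X: "padic_Cauchy p X" and Y: "padic_null p Y"
  shows "padic_null p (\<lambda>n. X n * Y n)"
  unfolding padic_null_def
proof (intro allI impI)
  fix r :: real assume r: "r > 0"
  obtain b k where b: "b > 0" "\<And>n. n \<ge> k \<Longrightarrow> padic_abs p (X n) \<le> b"
    using padic_Cauchy_bounded[OF X] by metis
  obtain i where i: "\<forall>n\<ge>i. padic_abs p (Y n) < r / b"
    using Y r b(1) unfolding padic_null_def by (meson divide_pos_pos)
  have "padic_abs p (X n * Y n) < r" if "n \<ge> max k i" for n
  proof -
    have "padic_abs p (X n * Y n) \<le> b * padic_abs p (Y n)"
      using b that padic_abs_nonneg[OF p] by (simp add: padic_abs_mult[OF p] mult_right_mono)
    also have "\<dots> < b * (r / b)" using i that b(1) by (intro mult_strict_left_mono) auto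
    finally show ?thesis using b(1) by simp
  qed
  then show "\<exists>k. \<forall>n\<ge>k. padic_abs p (X n * Y n) < r" by blast
qed

lemma padic_Cauchy_mult:
  assumes X: "padic_Cauchy p X" and Y: "padic_Cauchy p Y"
  shows "padic_Cauchy p (\<lambda>n. X n * Y n)"
  unfolding padic_Cauchy_def
proof (intro allI impI)
  fix r :: real assume r: "r > 0"
  obtain b k where b: "b > 0" "\<And>n. n \<ge> k \<Longrightarrow> padic_abs p (X n) \<le> b"
    using padic_Cauchy_bounded[OF X] by metis
  obtain c l where c: "c > 0" "\<And>n. n \<ge> l \<Longrightarrow> padic_abs p (Y n) \<le> c"
    using padic_Cauchy_bounded[OF Y] by metis
  obtain i where i: "\<forall>m\<ge>i. \<forall>n\<ge>i. padic_abs p (X m - X n) < r / c"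
    using X r c(1) unfolding padic_Cauchy_def by (meson divide_pos_pos)
  obtain j where j: "\<forall>m\<ge>j. \<forall>n\<ge>j. padic_abs p (Y m - Y n) < r / b"
    using Y r b(1) unfolding padic_Cauchy_def by (meson divide_pos_pos)
  have "padic_abs p (X m * Y m - X n * Y n) < r"
    if "m \<ge> max (max k l) (max i j)" "n \<ge> max (max k l) (max i j)" for m n
  proof -
    have "padic_abs p (X m * (Y m - Y n)) \<le> b * padic_abs p (Y m - Y n)"
      using b that padic_abs_nonneg[OF p] by (simp add: padic_abs_mult[OF p] mult_right_mono)
    also have "\<dots> < b * (r / b)" using j that b(1) by (intro mult_strict_left_mono) auto
    finally have 1: "padic_abs p (X m * (Y m - Y n)) < r" using b(1) by simp
    have "padic_abs p ((X m - X n) * Y n) \<le> padic_abs p (X m - X n) * c"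
      using c that padic_abs_nonneg[OF p] by (simp add: padic_abs_mult[OF p] mult_left_mono)
    also have "\<dots> < (r / c) * c" using i that c(1) by (intro mult_strict_right_mono) auto
    finally have 2: "padic_abs p ((X m - X n) * Y n) < r" using c(1) by simp
    show ?thesis
      unfolding mult_diff_mult using 1 2 by (intro le_less_trans[OF padic_abs_ultrametric[OF p]]) simp
  qed
  then show "\<exists>k. \<forall>m\<ge>k. \<forall>n\<ge>k. padic_abs p (X m * Y m - X n * Y n) < r" by blast
qed

lemma padic_Cauchy_inverse:
  assumes X: "padic_Cauchy p X" "\<not> padic_null p X"
  shows "padic_Cauchy p (\<lambda>n. inverse (X n))"
  unfolding padic_Cauchy_def
proof (intro allI impI)
  fix r :: real assume r: "r > 0"
  obtain c k where c: "c > 0" "\<And>n. n \<ge> k \<Longrightarrow> padic_abs p (X n) = c"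
    using padic_Cauchy_not_null[OF X] by metis
  have "r * (c * c) > 0" using r c(1) by simp
  then obtain i where i: "\<forall>m\<ge>i. \<forall>n\<ge>i. padic_abs p (X m - X n) < r * (c * c)"
    using X(1) unfolding padic_Cauchy_def by meson
  have "padic_abs p (inverse (X m) - inverse (X n)) < r" if "m \<ge> max i k" "n \<ge> max i k" for m n
  proof -
    have nz: "X m \<noteq> 0" "X n \<noteq> 0" using c that padic_abs_0[of p] by (metis less_irrefl max.boundedE)+
    have "padic_abs p (inverse (X m) - inverse (X n)) = padic_abs p (X m - X n) / (c * c)"
      using c that
      by (simp only: inverse_diff_inverse[OF nz] padic_abs_minus[OF p] padic_abs_mult[OF p]
          padic_abs_inverse[OF p]) (simp add: field_simps)
    also have "\<dots> < r" using i that c(1) by (simp add: pos_divide_less_eq)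
    finally show ?thesis .
  qed
  then show "\<exists>k. \<forall>m\<ge>k. \<forall>n\<ge>k. padic_abs p (inverse (X m) - inverse (X n)) < r" by blast
qed

lemma padic_null_diff_cong:
  assumes "padic_null p (\<lambda>n. X n - Y n)"
  shows "padic_null p X \<longleftrightarrow> padic_null p Y"
  using padic_null_add[OF assms, of Y] padic_null_add[OF _ padic_null_minus[OF assms], of X] by auto

lemma padic_null_diff_inverse:
  assumes C: "padic_Cauchy p X" "padic_Cauchy p Y"
    and n: "padic_null p (\<lambda>n. X n - Y n)" and nX: "\<not> padic_null p X"
  shows "padic_null p (\<lambda>n. inverse (X n) - inverse (Y n))"
proof -
  have nY: "\<not> padic_null p Y" using nX padic_null_diff_cong[OF n] by simp
  note inv = padic_Cauchy_inverse[OF C(1) nX] padic_Cauchy_inverse[OF C(2) nY]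
  obtain c k where c: "c > 0" "\<And>n. n \<ge> k \<Longrightarrow> padic_abs p (X n) = c"
    using padic_Cauchy_not_null[OF C(1) nX] by metis
  obtain d l where d: "d > 0" "\<And>n. n \<ge> l \<Longrightarrow> padic_abs p (Y n) = d"
    using padic_Cauchy_not_null[OF C(2) nY] by metis
  have null: "padic_null p (\<lambda>n. inverse (X n) * (inverse (Y n) * - (X n - Y n)))"
    by (intro padic_null_mult inv padic_null_minus n)
  have eq: "inverse (X n) * (inverse (Y n) * - (X n - Y n)) = inverse (X n) - inverse (Y n)"
    if "n \<ge> max k l" for n
  proof -
    have "X n \<noteq> 0" "Y n \<noteq> 0"
      using c d that padic_abs_0[of p] by (metis less_irrefl max.boundedE)+
    then show ?thesis by (simp add: field_simps)
  qed
  show ?thesis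
    unfolding padic_null_def
  proof (intro allI impI)
    fix r :: real assume "r > 0"
    then obtain i where i: "\<forall>n\<ge>i. padic_abs p (inverse (X n) * (inverse (Y n) * - (X n - Y n))) < r"
      using null unfolding padic_null_def by blast
    have "\<forall>n\<ge>max i (max k l). padic_abs p (inverse (X n) - inverse (Y n)) < r"
      using i eq by (metis max.boundedE)
    then show "\<exists>k. \<forall>n\<ge>k. padic_abs p (inverse (X n) - inverse (Y n)) < r" ..
  qed
qed

lemma padic_null_iff_tendsto: "padic_null p X \<longleftrightarrow> (\<lambda>n. padic_abs p (X n)) \<longlonglongrightarrow> 0"
  by (simp add: padic_null_def LIMSEQ_iff padic_abs_nonneg[OF p])

lemma padic_Cauchy_abs_convergent:
  assumes "padic_Cauchy p X"
  shows "convergent (\<lambda>n. padic_abs p (X n))"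
proof (cases "padic_null p X")
  case True
  then show ?thesis by (auto simp: padic_null_iff_tendsto convergent_def)
next
  case False
  then obtain c k where "\<And>n. n \<ge> k \<Longrightarrow> padic_abs p (X n) = c"
    using padic_Cauchy_not_null[OF assms] by metis
  then have "(\<lambda>n. padic_abs p (X n)) \<longlonglongrightarrow> c"
    by (intro tendsto_eventually) (auto simp: eventually_sequentially)
  then show ?thesis by (auto simp: convergent_def)
qed

lemma padic_abs_lim_cong:
  assumes C: "padic_Cauchy p X" and n: "padic_null p (\<lambda>n. X n - Y n)"
  shows "lim (\<lambda>n. padic_abs p (X n)) = lim (\<lambda>n. padic_abs p (Y n))"
proof (cases "padic_null p X")
  case True
  then have "padic_null p Y" using padic_null_diff_cong[OF n] by simp
  then show ?thesis using True by (auto simp: padic_null_iff_tendsto dest!: limI)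
next
  case False
  obtain c k where c: "c > 0" "\<And>n. n \<ge> k \<Longrightarrow> padic_abs p (X n) = c"
    using padic_Cauchy_not_null[OF C False] by metis
  obtain i where i: "\<forall>n\<ge>i. padic_abs p (X n - Y n) < c"
    using n c(1) unfolding padic_null_def by blast
  have "padic_abs p (Y n) = c" if "n \<ge> max i k" for n
    using that i c padic_abs_eqI[of "Y n" "X n"] padic_abs_diff_commute[OF p, of "X n" "Y n"]
    by (metis max.boundedE)
  then have "(\<lambda>n. padic_abs p (Y n)) \<longlonglongrightarrow> c"
    by (intro tendsto_eventually) (auto simp: eventually_sequentially intro!: exI[of _ "max i k"])
  moreover have "(\<lambda>n. padic_abs p (X n)) \<longlonglongrightarrow> c"
    using c by (intro tendsto_eventually) (auto simp: eventually_sequentially)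
  ultimately show ?thesis by (simp add: limI)
qed

end

text \<open>
  The prime is carried by the type: \<open>'p\<close> ranges over the types with a prime number of
  elements, and \<open>'p padic\<close> is the field of \<open>p\<close>-adic numbers for \<open>p = CARD('p)\<close>.
\<close>

typedef (overloaded) 'p padic_seq = "{X. padic_Cauchy CARD('p::prime_card) X}"
  using padic_Cauchy_const[OF prime_card] by blast

setup_lifting type_definition_padic_seq

instantiation padic_seq :: (prime_card) comm_ring_1
begin

lift_definition zero_padic_seq :: "'a padic_seq" is "\<lambda>n. 0"
  by (rule padic_Cauchy_const[OF prime_card])

lift_definition one_padic_seq :: "'a padic_seq" is "\<lambda>n. 1"
  by (rule padic_Cauchy_const[OF prime_card])

lift_definition plus_padic_seq :: "'a padic_seq \<Rightarrow> 'a padic_seq \<Rightarrow> 'a padic_seq"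
  is "\<lambda>X Y n. X n + Y n"
  by (rule padic_Cauchy_add[OF prime_card])

lift_definition uminus_padic_seq :: "'a padic_seq \<Rightarrow> 'a padic_seq" is "\<lambda>X n. - X n"
  by (rule padic_Cauchy_minus[OF prime_card])

lift_definition minus_padic_seq :: "'a padic_seq \<Rightarrow> 'a padic_seq \<Rightarrow> 'a padic_seq"
  is "\<lambda>X Y n. X n - Y n"
  by (drule padic_Cauchy_minus[OF prime_card], drule (1) padic_Cauchy_add[OF prime_card]) simp

lift_definition times_padic_seq :: "'a padic_seq \<Rightarrow> 'a padic_seq \<Rightarrow> 'a padic_seq"
  is "\<lambda>X Y n. X n * Y n"
  by (rule padic_Cauchy_mult[OF prime_card])

instance
  by standard (transfer, auto simp: algebra_simps fun_eq_iff)+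

end

lift_definition padic_seq_null :: "'p::prime_card padic_seq \<Rightarrow> bool" is "padic_null CARD('p)" .

lift_definition padic_seq_inverse :: "'p::prime_card padic_seq \<Rightarrow> 'p padic_seq"
  is "\<lambda>X. if padic_null CARD('p) X then (\<lambda>n. 0) else (\<lambda>n. inverse (X n))"
  by (simp add: padic_Cauchy_const[OF prime_card] padic_Cauchy_inverse[OF prime_card])

lift_definition padic_seq_norm :: "'p::prime_card padic_seq \<Rightarrow> real"
  is "\<lambda>X. lim (\<lambda>n. padic_abs CARD('p) (X n))" .

lemma padic_seq_null_0: "padic_seq_null 0"
  by transfer (rule padic_null_0[OF prime_card])

lemma padic_seq_null_minus: "padic_seq_null X \<Longrightarrow> padic_seq_null (- X)"
  by transfer (rule padic_null_minus[OF prime_card])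

lemma padic_seq_null_add: "padic_seq_null X \<Longrightarrow> padic_seq_null Y \<Longrightarrow> padic_seq_null (X + Y)"
  by transfer (rule padic_null_add[OF prime_card])

lemma padic_seq_null_mult: "padic_seq_null Y \<Longrightarrow> padic_seq_null (X * Y)"
  by transfer (rule padic_null_mult[OF prime_card])

lemma padic_seq_null_mult_inverse:
  "\<not> padic_seq_null X \<Longrightarrow> padic_seq_null (padic_seq_inverse X * X - 1)"
proof transfer
  fix X :: "nat \<Rightarrow> rat"
  let ?p = "CARD('a)"
  assume X: "padic_Cauchy ?p X" "\<not> padic_null ?p X"
  obtain c k where c: "c > 0" "\<And>n. n \<ge> k \<Longrightarrow> padic_abs ?p (X n) = c"
    using padic_Cauchy_not_null[OF prime_card X] by metis
  have "X n \<noteq> 0" if "n \<ge> k" for n using c that padic_abs_0 by (metis less_irrefl)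
  then show "padic_null ?p (\<lambda>n. (if padic_null ?p X then \<lambda>n. 0 else (\<lambda>n. inverse (X n))) n * X n - 1)"
    by (subst if_not_P[OF X(2)]) (auto simp: padic_null_def intro!: exI[of _ k])
qed

lemma padic_seq_inverse_0: "padic_seq_inverse 0 = 0"
  by transfer (simp add: padic_null_0[OF prime_card])

lemma padic_seq_not_null_1: "\<not> padic_seq_null 1"
  by transfer (auto simp: padic_null_def padic_abs_1[OF prime_card] intro!: exI[of _ "1::real"])

lemma padic_seq_null_diff_inverse:
  "padic_seq_null (X - Y) \<Longrightarrow> padic_seq_null (padic_seq_inverse X - padic_seq_inverse Y)"
  by transfer
    (auto simp: padic_null_0[OF prime_card] padic_null_diff_cong[OF prime_card]
          intro: padic_null_diff_inverse[OF prime_card])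

lemma padic_seq_norm_tendsto:
  fixes X :: "'p::prime_card padic_seq"
  shows "(\<lambda>n. padic_abs CARD('p) (Rep_padic_seq X n)) \<longlonglongrightarrow> padic_seq_norm X"
  by transfer (simp add: convergent_LIMSEQ_iff[symmetric] padic_Cauchy_abs_convergent[OF prime_card])

lemma padic_seq_norm_cong: "padic_seq_null (X - Y) \<Longrightarrow> padic_seq_norm X = padic_seq_norm Y"
  by transfer (rule padic_abs_lim_cong[OF prime_card])

lemma padic_seq_norm_eq_0_iff: "padic_seq_norm X = 0 \<longleftrightarrow> padic_seq_null X"
  using padic_seq_norm_tendsto[of X] LIMSEQ_unique
  by (auto simp: padic_seq_null.rep_eq padic_null_iff_tendsto[OF prime_card])

lemma padic_seq_norm_minus: "padic_seq_norm (- X) = padic_seq_norm X"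
  by transfer (simp add: padic_abs_minus[OF prime_card])

lemma padic_seq_norm_add: "padic_seq_norm (X + Y) \<le> max (padic_seq_norm X) (padic_seq_norm Y)"
  by (rule LIMSEQ_le[OF padic_seq_norm_tendsto
        tendsto_max[OF padic_seq_norm_tendsto padic_seq_norm_tendsto]])
     (simp add: plus_padic_seq.rep_eq padic_abs_ultrametric[OF prime_card])

lemma padic_seq_norm_nonneg: "padic_seq_norm X \<ge> 0"
  by (rule LIMSEQ_le_const[OF padic_seq_norm_tendsto]) (simp add: padic_abs_nonneg[OF prime_card])

quotient_type (overloaded) 'p padic = "'p::prime_card padic_seq" / "\<lambda>X Y. padic_seq_null (X - Y)"
proof (rule equivpI)
  show "reflp (\<lambda>X Y :: 'p padic_seq. padic_seq_null (X - Y))"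
    by (rule reflpI) (simp add: padic_seq_null_0)
  show "symp (\<lambda>X Y :: 'p padic_seq. padic_seq_null (X - Y))"
    by (rule sympI) (drule padic_seq_null_minus, simp)
  show "transp (\<lambda>X Y :: 'p padic_seq. padic_seq_null (X - Y))"
    by (rule transpI) (drule (1) padic_seq_null_add, simp)
qed

instantiation padic :: (prime_card) field
begin

lift_definition zero_padic :: "'a padic" is 0 .

lift_definition one_padic :: "'a padic" is 1 .

lift_definition plus_padic :: "'a padic \<Rightarrow> 'a padic \<Rightarrow> 'a padic" is "(+)"
  unfolding add_diff_add by (rule padic_seq_null_add)

lift_definition uminus_padic :: "'a padic \<Rightarrow> 'a padic" is uminus
  unfolding minus_diff_minus by (rule padic_seq_null_minus)

lift_definition minus_padic :: "'a padic \<Rightarrow> 'a padic \<Rightarrow> 'a padic" is "(-)"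
  by (drule padic_seq_null_minus, drule (1) padic_seq_null_add) (simp add: algebra_simps)

lift_definition times_padic :: "'a padic \<Rightarrow> 'a padic \<Rightarrow> 'a padic" is "(*)"
  unfolding mult_diff_mult
  by (rule padic_seq_null_add, rule padic_seq_null_mult, assumption,
      subst mult.commute, rule padic_seq_null_mult)

lift_definition inverse_padic :: "'a padic \<Rightarrow> 'a padic" is padic_seq_inverse
  by (rule padic_seq_null_diff_inverse)

definition divide_padic :: "'a padic \<Rightarrow> 'a padic \<Rightarrow> 'a padic" where
  "divide_padic x y = x * inverse y"

instance
proof
  fix a b c :: "'a padic"
  note [simp] = padic_seq_null_0
  show "a + b + c = a + (b + c)" by transfer (simp add: add.assoc)
  show "a + b = b + a" by transfer (simp add: add.commute)
  show "0 + a = a" by transfer simp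
  show "- a + a = 0" by transfer simp
  show "a - b = a + - b" by transfer simp
  show "a * b * c = a * (b * c)" by transfer (simp add: mult.assoc)
  show "a * b = b * a" by transfer (simp add: mult.commute)
  show "1 * a = a" by transfer simp
  show "(a + b) * c = a * c + b * c" by transfer (simp add: distrib_right)
  show "(0 :: 'a padic) \<noteq> 1"
    by transfer (use padic_seq_null_minus padic_seq_not_null_1 in fastforce)
  show "a div b = a * inverse b" by (rule divide_padic_def)
  show "inverse (0 :: 'a padic) = 0"
    by transfer (simp add: padic_seq_inverse_0)
  show "inverse a * a = 1" if "a \<noteq> 0"
    using that by transfer (simp add: padic_seq_null_mult_inverse)
qed

end

lift_definition padic_norm :: "'p::prime_card padic \<Rightarrow> real" is padic_seq_norm
  by (rule padic_seq_norm_cong)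

instantiation padic :: (prime_card) metric_space
begin

definition dist_padic :: "'a padic \<Rightarrow> 'a padic \<Rightarrow> real" where
  "dist_padic x y = padic_norm (x - y)"

definition uniformity_padic :: "('a padic \<times> 'a padic) filter" where
  "uniformity_padic = (INF e\<in>{0<..}. principal {(x, y). dist x y < e})"

definition open_padic :: "'a padic set \<Rightarrow> bool" where
  "open_padic U \<longleftrightarrow> (\<forall>x\<in>U. \<forall>\<^sub>F (x', y) in uniformity. x' = x \<longrightarrow> y \<in> U)"

instance
proof
  fix x y z :: "'a padic" and U :: "'a padic set"
  show "uniformity = (INF e\<in>{0<..}. principal {(x, y :: 'a padic). dist x y < e})"
    by (rule uniformity_padic_def)
  show "open U \<longleftrightarrow> (\<forall>x\<in>U. \<forall>\<^sub>F (x', y) in uniformity. x' = x \<longrightarrow> y \<in> U)"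
    by (rule open_padic_def)
  show "dist x y = 0 \<longleftrightarrow> x = y"
    unfolding dist_padic_def by transfer (simp add: padic_seq_norm_eq_0_iff)
  have nonneg: "padic_norm a \<ge> 0" for a :: "'a padic" by transfer (rule padic_seq_norm_nonneg)
  have minus: "padic_norm (- a) = padic_norm a" for a :: "'a padic" by transfer (rule padic_seq_norm_minus)
  have add: "padic_norm (a + b) \<le> max (padic_norm a) (padic_norm b)" for a b :: "'a padic"
    by transfer (rule padic_seq_norm_add)
  show "dist x y \<le> dist x z + dist y z"
    using add[of "x - z" "z - y"] minus[of "y - z"] nonneg[of "x - z"] nonneg[of "y - z"]
    by (simp add: dist_padic_def)
qed

end

section \<open>Fourier analysis on \<open>\<rat>\<^sub>p\<^sup>n\<close>\<close>

text \<open>\<open>\<rat>\<^sub>p\<^sup>n\<close> is the type \<open>'p padic ^ 'n\<close> with \<open>n = CARD('n)\<close>; it carries the product topology.\<close>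

abbreviation prime_pow :: "int \<Rightarrow> 'p::prime_card padic" where
  "prime_pow k \<equiv> of_nat CARD('p) powi k"

definition padic_integers :: "'p::prime_card padic set" where
  "padic_integers = {x. padic_norm x \<le> 1}"

definition padic_integer_vecs :: "('p::prime_card padic ^ 'n) set" where
  "padic_integer_vecs = {x. \<forall>j. x $ j \<in> padic_integers}"

definition max_norm :: "'p::prime_card padic ^ 'n \<Rightarrow> real" where
  "max_norm x = Max (range (\<lambda>j. padic_norm (x $ j)))"

text \<open>
  For \<open>y\<close> outside \<open>\<int>\<^sub>p\<close>, the digits of the expansion
  \<open>y = p\<^sup>k (d\<^sub>0 + d\<^sub>1 p + \<dots>)\<close> with \<open>k < 0\<close> and \<open>d\<^sub>0 \<noteq> 0\<close> are unique, and the fractional part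
  is the sum of the finitely many terms with negative exponent, read as a real number.
\<close>

definition padic_frac :: "'p::prime_card padic \<Rightarrow> real" where
  "padic_frac y = (if y \<in> padic_integers then 0 else
     (THE r. \<exists>(k::int) (d::nat \<Rightarrow> nat). k < 0 \<and> (\<forall>i. d i < CARD('p)) \<and> d 0 \<noteq> 0 \<and>
        (\<lambda>i. of_nat (d i) * prime_pow (k + int i)) sums y \<and>
        r = (\<Sum>i<nat (- k). real (d i) * real CARD('p) powi (k + int i))))"

text \<open>\<open>padic_char \<xi> x\<close> is \<open>\<chi>\<^sub>p(\<xi> \<cdot> x)\<close>.\<close>

definition padic_char :: "'p::prime_card padic ^ 'n \<Rightarrow> 'p padic ^ 'n \<Rightarrow> complex" where
  "padic_char \<xi> x = exp (2 * of_real pi * \<i> * of_real (\<Sum>j\<in>UNIV. padic_frac (\<xi> $ j * x $ j)))"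

text \<open>
  The Haar measure normalised by giving \<open>\<int>\<^sub>p\<^sup>n\<close> mass 1. The translates of the compact open
  subgroup \<open>\<int>\<^sub>p\<^sup>n\<close> cover \<open>\<rat>\<^sub>p\<^sup>n\<close> countably often, so the normalisation already forces the measure to
  be locally finite and the three conditions determine it.
\<close>

definition haar :: "('p::prime_card padic ^ 'n) measure" where
  "haar = (THE M. sets M = sets borel \<and> (\<forall>a. distr M borel (\<lambda>x. a + x) = M) \<and>
     emeasure M padic_integer_vecs = 1)"

definition locally_constant_on :: "'a::topological_space set \<Rightarrow> ('a \<Rightarrow> complex) \<Rightarrow> bool" where
  "locally_constant_on S f \<longleftrightarrow>
     (\<forall>x\<in>S. \<exists>U. open U \<and> x \<in> U \<and> (\<forall>y\<in>U \<inter> S. f y = f x))"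

definition test_functions :: "('p::prime_card padic ^ 'n \<Rightarrow> complex) set" where
  "test_functions = {\<phi>. locally_constant_on UNIV \<phi> \<and> compact (closure {x. \<phi> x \<noteq> 0})}"

definition fourier ::
    "('p::prime_card padic ^ 'n \<Rightarrow> complex) \<Rightarrow> 'p padic ^ 'n \<Rightarrow> complex" where
  "fourier \<phi> \<xi> = (LINT x|haar. padic_char \<xi> x * \<phi> x)"

definition inv_fourier ::
    "('p::prime_card padic ^ 'n \<Rightarrow> complex) \<Rightarrow> 'p padic ^ 'n \<Rightarrow> complex" where
  "inv_fourier \<psi> x = (LINT \<xi>|haar. padic_char (- x) \<xi> * \<psi> \<xi>)"

definition lizorkin_functions :: "('p::prime_card padic ^ 'n \<Rightarrow> complex) set" where
  "lizorkin_functions = fourier ` {\<psi> \<in> test_functions. \<psi> 0 = 0}"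

text \<open>
  A symbol lives on \<open>\<rat>\<^sub>p\<^sup>n - {0}\<close>; as a total function it has a meaningless value at \<open>0\<close>,
  which is overridden by \<open>0\<close> here.
\<close>

definition pseudo_diff_op :: "('p::prime_card padic ^ 'n \<Rightarrow> complex) \<Rightarrow>
    ('p padic ^ 'n \<Rightarrow> complex) \<Rightarrow> 'p padic ^ 'n \<Rightarrow> complex" where
  "pseudo_diff_op A \<phi> = inv_fourier (\<lambda>\<xi>. if \<xi> = 0 then 0 else A \<xi> * fourier \<phi> \<xi>)"

definition eigenfunction ::
    "(('p::prime_card padic ^ 'n \<Rightarrow> complex) \<Rightarrow> 'p padic ^ 'n \<Rightarrow> complex) \<Rightarrow>
     ('p padic ^ 'n \<Rightarrow> complex) \<Rightarrow> bool" where
  "eigenfunction T \<phi> \<longleftrightarrow> \<phi> \<in> lizorkin_functions \<and> \<phi> \<noteq> (\<lambda>x. 0) \<and>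
     (\<exists>c. T \<phi> = (\<lambda>x. c * \<phi> x))"

section \<open>Wavelets\<close>

definition I_set :: "'p::prime_card padic set" where
  "I_set = {prime_pow (- int k) * (\<Sum>i<k. of_nat (a i) * of_nat CARD('p) ^ i) | k a.
     k \<ge> 1 \<and> (\<forall>i<k. a i < CARD('p))}"

definition I_vecs :: "('p::prime_card padic ^ 'n) set" where
  "I_vecs = {a. \<forall>j. a $ j \<in> I_set}"

definition J_set :: "nat \<Rightarrow> 'p::prime_card padic set" where
  "J_set k = {prime_pow (- int k) * (\<Sum>i<k. of_nat (s i) * of_nat CARD('p) ^ i) | s.
     (\<forall>i<k. s i < CARD('p)) \<and> s 0 \<noteq> 0}"

definition J_vecs :: "('n \<Rightarrow> nat) \<Rightarrow> ('p::prime_card padic ^ 'n) set" where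
  "J_vecs m = {s. \<forall>j. s $ j \<in> J_set (m j)}"

definition Omega :: "real \<Rightarrow> real" where
  "Omega t = (if 0 \<le> t \<and> t \<le> 1 then 1 else 0)"

definition wavelet ::
    "int \<Rightarrow> 'p::prime_card padic ^ 'n \<Rightarrow> 'p padic ^ 'n \<Rightarrow> 'p padic ^ 'n \<Rightarrow> complex" where
  "wavelet \<gamma> s a x =
     of_real (real CARD('p) powr (- (real CARD('n) * of_int \<gamma> / 2))) *
     padic_char s (prime_pow \<gamma> *s x - a) * of_real (Omega (max_norm (prime_pow \<gamma> *s x - a)))"

end

theory Submission
  imports Defs
begin

text \<open>
  For \<open>\<zeta>, b \<in> \<rat>\<^sub>p\<^sup>n\<close> and an integer \<open>k\<close> let \<open>u(\<zeta>, b, k)\<close> (\<open>ball_char\<close> below) be the character \<open>\<chi>\<^sub>p(\<zeta> \<cdot> x)\<close> cut off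
  to the ball of radius \<open>p\<^sup>-\<^sup>k\<close> around \<open>b\<close>. Orthogonality of characters on a ball gives
  \<open>F[u(\<zeta>, b, k)] = p\<^sup>-\<^sup>n\<^sup>k \<chi>\<^sub>p(\<zeta> \<cdot> b) u(b, -\<zeta>, -k)\<close>, so this family is stable under \<open>F\<close> and \<open>F[F[u]](x) = u(-x)\<close>
  on it. By compactness a locally constant function supported in a ball is a finite linear
  combination of indicators of balls, so the same inversion formula holds for it. The wavelet is a nonzero
  multiple of \<open>u(p\<^sup>\<gamma> s, p\<^sup>-\<^sup>\<gamma> a, -\<gamma>)\<close>; its transform vanishes exactly outside
  \<open>p\<^sup>\<gamma>(-s + \<int>\<^sub>p\<^sup>n)\<close>, a ball which does not contain \<open>0\<close> because \<open>s \<notin> \<int>\<^sub>p\<^sup>n\<close>. Inverting the transform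
  of \<open>A \<Theta> = \<mu> \<Theta>\<close> turns it into the statement that the symbol equals \<open>\<mu>\<close> on this ball.

  Haar measure is obtained by Caratheodory extension from the ring of compact open sets,
  on which countable additivity reduces to finite additivity; it is unique because each ball is the
  disjoint union of \<open>p\<^sup>n\<close> translates of the next smaller ball.
\<close>

section \<open>The norm on \<open>\<rat>\<^sub>p\<close>\<close>

lemma padic_norm_nonneg [simp]: "padic_norm x \<ge> 0"
  by transfer (rule padic_seq_norm_nonneg)

lemma padic_norm_eq_0_iff [simp]: "padic_norm x = 0 \<longleftrightarrow> x = 0"
  by transfer (simp add: padic_seq_norm_eq_0_iff)

lemma padic_norm_minus [simp]: "padic_norm (- x) = padic_norm x"
  by transfer (rule padic_seq_norm_minus)

lemma padic_norm_diff_commute: "padic_norm (x - y) = padic_norm (y - x)"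
  using padic_norm_minus[of "x - y"] by simp

lemma padic_norm_add: "padic_norm (x + y) \<le> max (padic_norm x) (padic_norm y)"
  by transfer (rule padic_seq_norm_add)

lemma padic_norm_add_le: "padic_norm x \<le> r \<Longrightarrow> padic_norm y \<le> r \<Longrightarrow> padic_norm (x + y) \<le> r"
  using padic_norm_add[of x y] by linarith

lemma padic_norm_diff_le: "padic_norm x \<le> r \<Longrightarrow> padic_norm y \<le> r \<Longrightarrow> padic_norm (x - y) \<le> r"
  using padic_norm_add_le[of x r "- y"] by simp

lemma padic_seq_norm_mult: "padic_seq_norm (X * Y) = padic_seq_norm X * padic_seq_norm Y"
proof (rule LIMSEQ_unique[OF padic_seq_norm_tendsto])
  show "(\<lambda>n. padic_abs CARD('a) (Rep_padic_seq (X * Y) n)) \<longlonglongrightarrow> padic_seq_norm X * padic_seq_norm Y"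
    using tendsto_mult[OF padic_seq_norm_tendsto[of X] padic_seq_norm_tendsto[of Y]]
    by (simp add: times_padic_seq.rep_eq padic_abs_mult[OF prime_card])
qed

lemma padic_norm_mult: "padic_norm (x * y) = padic_norm x * padic_norm y"
  by transfer (rule padic_seq_norm_mult)

section \<open>The dense embedding of the rationals, and norms of integers\<close>

lift_definition const_padic_seq :: "rat \<Rightarrow> 'p::prime_card padic_seq" is "\<lambda>q n. q"
  by (rule padic_Cauchy_const[OF prime_card])

lift_definition padic_of_rat :: "rat \<Rightarrow> 'p::prime_card padic" is const_padic_seq .

lemma padic_of_rat_0 [simp]: "padic_of_rat 0 = 0"
proof transfer
  have "const_padic_seq 0 = (0 :: 'a padic_seq)" by transfer (rule refl)
  then show "padic_seq_null (const_padic_seq 0 - (0 :: 'a padic_seq))"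
    by (simp add: padic_seq_null_0)
qed

lemma padic_of_rat_1 [simp]: "padic_of_rat 1 = 1"
proof transfer
  have "const_padic_seq 1 = (1 :: 'a padic_seq)" by transfer (rule refl)
  then show "padic_seq_null (const_padic_seq 1 - (1 :: 'a padic_seq))"
    by (simp add: padic_seq_null_0)
qed

lemma padic_of_rat_add: "padic_of_rat (x + y) = padic_of_rat x + padic_of_rat y"
proof transfer
  fix x y :: rat
  have "const_padic_seq (x + y) = (const_padic_seq x + const_padic_seq y :: 'a padic_seq)"
    by transfer (rule refl)
  then show "padic_seq_null (const_padic_seq (x + y) - (const_padic_seq x + const_padic_seq y :: 'a padic_seq))"
    by (simp add: padic_seq_null_0)
qed

lemma padic_of_rat_mult: "padic_of_rat (x * y) = padic_of_rat x * padic_of_rat y"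
proof transfer
  fix x y :: rat
  have "const_padic_seq (x * y) = (const_padic_seq x * const_padic_seq y :: 'a padic_seq)"
    by transfer (rule refl)
  then show "padic_seq_null (const_padic_seq (x * y) - (const_padic_seq x * const_padic_seq y :: 'a padic_seq))"
    by (simp add: padic_seq_null_0)
qed

lemma padic_of_rat_diff: "padic_of_rat (x - y) = padic_of_rat x - padic_of_rat y"
  using padic_of_rat_add[of "x - y" y] by (metis add_diff_cancel_right' diff_add_cancel)

lemma padic_of_rat_of_nat: "padic_of_rat (of_nat n) = of_nat n"
  by (induction n) (simp_all add: padic_of_rat_add)

lemma padic_of_rat_of_int: "padic_of_rat (of_int n) = of_int n"
  by (cases n rule: int_diff_cases) (simp add: padic_of_rat_diff padic_of_rat_of_nat)

lemma padic_norm_of_rat: "padic_norm (padic_of_rat q :: 'p::prime_card padic) = padic_abs CARD('p) q"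
proof transfer
  fix q show "padic_seq_norm (const_padic_seq q :: 'p padic_seq) = padic_abs CARD('p) q"
    by transfer (simp add: limI)
qed

text \<open>A late entry of a Cauchy sequence representing \<open>x\<close> serves as
  \<open>q\<close>. The limit defining the norm turns strict bounds into weak ones, so the Cauchy
  condition is taken at r/2.\<close>

lemma padic_of_rat_approx:
  fixes x :: "'p::prime_card padic"
  assumes "r > 0"
  obtains q where "padic_norm (x - padic_of_rat q) < r"
proof -
  obtain X where x: "x = abs_padic X" by (metis Quotient_abs_rep[OF Quotient_padic])
  have "\<exists>q. padic_norm (x - padic_of_rat q) < r"
  proof -
    have "padic_Cauchy CARD('p) (Rep_padic_seq X)" using Rep_padic_seq by blast
    then obtain k where k: "\<forall>m\<ge>k. \<forall>n\<ge>k. padic_abs CARD('p) (Rep_padic_seq X m - Rep_padic_seq X n) < r / 2"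
      unfolding padic_Cauchy_def using assms half_gt_zero by blast
    define q where "q = Rep_padic_seq X k"
    have "padic_seq_norm (X - const_padic_seq q) \<le> r / 2"
    proof (rule LIMSEQ_le_const2[OF padic_seq_norm_tendsto])
      show "\<exists>N. \<forall>n\<ge>N. padic_abs CARD('p) (Rep_padic_seq (X - const_padic_seq q) n) \<le> r / 2"
        using k by (intro exI[of _ k])
          (auto simp: minus_padic_seq.rep_eq const_padic_seq.rep_eq q_def intro: less_imp_le)
    qed
    then have "padic_norm (x - padic_of_rat q) \<le> r / 2"
      unfolding x padic_of_rat.abs_eq minus_padic.abs_eq padic_norm.abs_eq .
    then show ?thesis
      using assms by (intro exI[of _ q]) linarith
  qed
  then show ?thesis using that by blast
qed

lemma padic_norm_1 [simp]: "padic_norm (1 :: 'p::prime_card padic) = 1"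
  using padic_norm_of_rat[of 1, where 'p='p] by (simp add: padic_abs_1[OF prime_card])

lemma padic_norm_0 [simp]: "padic_norm 0 = 0"
  by simp

lemma padic_norm_of_int:
  assumes "n \<noteq> 0"
  shows "padic_norm (of_int n :: 'p::prime_card padic) = real CARD('p) powi (- int (multiplicity (int CARD('p)) n))"
  using padic_norm_of_rat[of "of_int n", where 'p='p] assms
  by (simp add: padic_of_rat_of_int padic_abs_def)

lemma padic_norm_of_int_le_1: "padic_norm (of_int n :: 'p::prime_card padic) \<le> 1"
proof (cases "n = 0")
  case False
  have "real CARD('p) powi (- int (multiplicity (int CARD('p)) n)) \<le> real CARD('p) powi 0"
    using prime_gt_1_nat[OF prime_card[where 'a='p]] by (intro power_int_increasing) auto
  then show ?thesis using False by (simp add: padic_norm_of_int)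
qed simp

text \<open>This is the bridge between the metric and divisibility by powers of p; facts about
  digits, fractional parts and the sets \<open>J_set\<close> all pass through it.\<close>

lemma padic_norm_of_int_le_iff:
  "padic_norm (of_int n :: 'p::prime_card padic) \<le> real CARD('p) powi (- int k) \<longleftrightarrow> int CARD('p) ^ k dvd n"
proof (cases "n = 0")
  case False
  note p = prime_gt_1_nat[OF prime_card[where 'a='p]]
  have "real CARD('p) powi (- int (multiplicity (int CARD('p)) n)) \<le> real CARD('p) powi (- int k)
     \<longleftrightarrow> k \<le> multiplicity (int CARD('p)) n"
    using p power_int_strict_increasing[of "- int (multiplicity (int CARD('p)) n)" "- int k" "real CARD('p)"]
      power_int_increasing[of "- int (multiplicity (int CARD('p)) n)" "- int k" "real CARD('p)"]
      power_int_strict_increasing[of "- int k" "- int (multiplicity (int CARD('p)) n)" "real CARD('p)"]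
    by (cases "k \<le> multiplicity (int CARD('p)) n") auto
  also have "\<dots> \<longleftrightarrow> int CARD('p) ^ k dvd n"
    using False p by (intro power_dvd_iff_le_multiplicity[symmetric] conjI) auto
  finally show ?thesis using False by (simp add: padic_norm_of_int)
qed simp

lemma prime_card_gt_1: "real CARD('p::prime_card) > 1"
  using prime_gt_1_nat[OF prime_card[where 'a='p]] by simp

lemma prime_card_nonzero [simp]: "(of_nat CARD('p) :: 'p::prime_card padic) \<noteq> 0"
proof -
  have "padic_norm (of_int (int CARD('p)) :: 'p padic) \<noteq> 0"
    using prime_card_gt_1[where 'p='p] by (subst padic_norm_of_int) (auto simp: power_int_not_zero)
  then show ?thesis by simp
qed

lemma padic_norm_prime: "padic_norm (of_nat CARD('p) :: 'p::prime_card padic) = 1 / real CARD('p)"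
proof -
  have "multiplicity (int CARD('p)) (int CARD('p)) = 1"
    using prime_card_gt_1[where 'p='p] by (intro multiplicity_self) auto
  then show ?thesis
    using padic_norm_of_int[of "int CARD('p)", where 'p='p] prime_card_gt_1[where 'p='p]
    by (simp add: power_int_minus field_simps)
qed

lemma padic_norm_inverse: "padic_norm (inverse x) = inverse (padic_norm x)"
proof (cases "x = 0")
  case False
  then have "padic_norm (inverse x) * padic_norm x = 1"
    by (simp flip: padic_norm_mult)
  then show ?thesis by (metis inverse_unique mult.commute)
qed simp

lemma padic_norm_power: "padic_norm (x ^ n) = padic_norm x ^ n"
  by (induction n) (simp_all add: padic_norm_mult)

lemma padic_norm_prime_pow [simp]:
  "padic_norm (prime_pow k :: 'p::prime_card padic) = real CARD('p) powi (- k)"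
  by (cases "k \<ge> 0")
    (simp_all add: power_int_def padic_norm_power padic_norm_inverse padic_norm_prime power_one_over
      flip: inverse_eq_divide)

lemma prime_pow_add: "prime_pow (k + l) = (prime_pow k * prime_pow l :: 'p::prime_card padic)"
  by (simp add: power_int_add)

lemma prime_pow_nonzero [simp]: "(prime_pow k :: 'p::prime_card padic) \<noteq> 0"
  by (simp add: power_int_not_zero)

lemma padic_norm_prime_pow_mult_le_iff:
  "padic_norm (prime_pow k * x :: 'p::prime_card padic) \<le> real CARD('p) powi l
    \<longleftrightarrow> padic_norm x \<le> real CARD('p) powi (k + l)"
  using prime_card_gt_1[where 'p='p] zero_less_power_int[of "real CARD('p)" k]
  by (simp add: padic_norm_mult power_int_minus power_int_add field_simps)

text \<open>A rational closer to \<open>x\<close> than the norm of \<open>x\<close> has the same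
  norm by the ultrametric inequality, and nonzero rationals have norms that are powers of p.\<close>

lemma padic_norm_prime_card_power:
  fixes x :: "'p::prime_card padic"
  assumes "x \<noteq> 0"
  obtains k where "padic_norm x = real CARD('p) powi k"
proof -
  obtain q where q: "padic_norm (x - padic_of_rat q) < padic_norm x"
    using padic_of_rat_approx[of "padic_norm x" x] assms
    by (metis order_le_less padic_norm_eq_0_iff padic_norm_nonneg)
  define y :: "'p padic" where "y = padic_of_rat q"
  have "padic_norm y \<le> padic_norm x"
    using q padic_norm_diff_le[of x "padic_norm x" "x - y"] by (simp add: y_def)
  moreover have "padic_norm x \<le> max (padic_norm (x - y)) (padic_norm y)"
    using padic_norm_add[of "x - y" y] by simp
  ultimately have "padic_norm x = padic_norm y" using q unfolding y_def by linarith
  moreover from this have "q \<noteq> 0" using assms by (auto simp: y_def)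
  ultimately show ?thesis
    using that by (simp add: y_def padic_norm_of_rat padic_abs_def)
qed

text \<open>Each term is replaced by a rational \<open>q n\<close> with error below 1/(n+1). The
  sequence \<open>q\<close> is again Cauchy, so it represents an element of the quotient, and this
  element is the limit.\<close>

lemma padic_complete:
  fixes X :: "nat \<Rightarrow> 'p::prime_card padic"
  assumes "Cauchy X"
  shows "convergent X"
proof -
  note p = prime_card[where 'a='p]
  have "\<exists>q. \<forall>n. padic_norm (X n - padic_of_rat (q n)) < inverse (real (Suc n))"
    by (intro choice allI) (metis padic_of_rat_approx inverse_positive_iff_positive of_nat_0_less_iff zero_less_Suc)
  then obtain q where q: "\<And>n. padic_norm (X n - padic_of_rat (q n)) < inverse (real (Suc n))" by blast
  have small: "\<exists>N. \<forall>n\<ge>N. padic_norm (X n - padic_of_rat (q n)) < r" if r: "r > 0" for r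
  proof -
    obtain N where N: "inverse (real (Suc N)) < r" using reals_Archimedean[OF r] by blast
    have "padic_norm (X n - padic_of_rat (q n)) < r" if "n \<ge> N" for n
    proof -
      have "inverse (real (Suc n)) \<le> inverse (real (Suc N))" using that by simp
      then show ?thesis using q[of n] N by linarith
    qed
    then show ?thesis by blast
  qed
  have C: "padic_Cauchy CARD('p) q"
    unfolding padic_Cauchy_def
  proof (intro allI impI)
    fix r :: real assume r: "r > 0"
    obtain N where N: "\<forall>n\<ge>N. padic_norm (X n - padic_of_rat (q n)) < r" using small[OF r] by blast
    obtain M where M: "\<forall>m\<ge>M. \<forall>n\<ge>M. dist (X m) (X n) < r"
      using assms r unfolding Cauchy_def by blast
    have "padic_abs CARD('p) (q m - q n) < r" if "m \<ge> max M N" "n \<ge> max M N" for m n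
    proof -
      have "padic_of_rat (q m - q n) = (X m - X n) + (X n - padic_of_rat (q n)) - (X m - padic_of_rat (q m))"
        by (simp add: padic_of_rat_diff)
      also have "padic_norm \<dots> \<le> max (max (dist (X m) (X n)) (padic_norm (X n - padic_of_rat (q n))))
          (padic_norm (X m - padic_of_rat (q m)))"
        unfolding dist_padic_def
        by (rule padic_norm_diff_le; (rule padic_norm_add_le)?; linarith)
      also have "\<dots> < r" using that M N by auto
      finally show ?thesis by (simp add: padic_norm_of_rat)
    qed
    then show "\<exists>k. \<forall>m\<ge>k. \<forall>n\<ge>k. padic_abs CARD('p) (q m - q n) < r" by blast
  qed
  define Q :: "'p padic_seq" where "Q = Abs_padic_seq q"
  have Q: "Rep_padic_seq Q = q" unfolding Q_def using C by (simp add: Abs_padic_seq_inverse)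
  define x where "x = abs_padic Q"
  \<comment> \<open>The norm of the difference is the limit over m of the absolute values of
    \<open>q n - q m\<close>, so a weak bound valid for all late m survives.\<close>
  have rat: "padic_norm (padic_of_rat (q n) - x) \<le> r"
    if "\<And>m. m \<ge> N \<Longrightarrow> padic_abs CARD('p) (q n - q m) \<le> r" for n r N
  proof -
    have "padic_norm (padic_of_rat (q n) - x) = padic_seq_norm (const_padic_seq (q n) - Q)"
      unfolding x_def padic_of_rat.abs_eq minus_padic.abs_eq padic_norm.abs_eq ..
    also have "\<dots> \<le> r"
    proof (rule LIMSEQ_le_const2[OF padic_seq_norm_tendsto])
      show "\<exists>N. \<forall>m\<ge>N. padic_abs CARD('p) (Rep_padic_seq (const_padic_seq (q n) - Q) m) \<le> r"
        using that by (intro exI[of _ N]) (auto simp: minus_padic_seq.rep_eq const_padic_seq.rep_eq Q)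
    qed
    finally show ?thesis .
  qed
  have "X \<longlonglongrightarrow> x"
    unfolding lim_sequentially
  proof (intro allI impI)
    fix r :: real assume r: "r > 0"
    obtain N where N: "\<forall>n\<ge>N. padic_norm (X n - padic_of_rat (q n)) < r" using small[OF r] by blast
    obtain M where M: "\<forall>m\<ge>M. \<forall>n\<ge>M. padic_abs CARD('p) (q m - q n) < r / 2"
      using C r unfolding padic_Cauchy_def by (meson half_gt_zero)
    have "dist (X n) x < r" if "n \<ge> max M N" for n
    proof -
      have "padic_norm (padic_of_rat (q n) - x) \<le> r / 2"
        using M that by (intro rat[of M]) (auto intro: less_imp_le)
      moreover have "padic_norm (X n - x) \<le> max (padic_norm (X n - padic_of_rat (q n))) (padic_norm (padic_of_rat (q n) - x))"
        using padic_norm_add[of "X n - padic_of_rat (q n)" "padic_of_rat (q n) - x"] by simp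
      ultimately show ?thesis using N that r unfolding dist_padic_def by fastforce
    qed
    then show "\<exists>N. \<forall>n\<ge>N. dist (X n) x < r" by blast
  qed
  then show ?thesis by (auto simp: convergent_def)
qed

text \<open>The residue field has p elements: \<open>x\<close> is close to a rational a/b with b
  prime to p, and the digit is a times the inverse of b modulo p.\<close>

lemma padic_digit:
  fixes x :: "'p::prime_card padic"
  assumes "padic_norm x \<le> 1"
  obtains d where "d < CARD('p)" "padic_norm (x - of_nat d) \<le> 1 / real CARD('p)"
proof -
  let ?p = "int CARD('p)"
  have p: "prime ?p" using prime_card[where 'a='p] by simp
  obtain q where q: "padic_norm (x - padic_of_rat q) < 1 / real CARD('p)"
    using padic_of_rat_approx[of "1 / real CARD('p)" x] prime_card_gt_1[where 'p='p] by auto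
  obtain a b where ab: "quotient_of q = (a, b)" by fastforce
  have cop: "coprime a b" and b: "b > 0" and qab: "q = of_int a / of_int b"
    using quotient_of_coprime[OF ab] quotient_of_denom_pos[OF ab] quotient_of_div[OF ab] by auto
  have q1: "padic_norm (padic_of_rat q :: 'p padic) \<le> 1"
  proof -
    have "padic_norm (x - (x - padic_of_rat q)) \<le> 1"
    proof (rule padic_norm_diff_le[OF assms])
      have "1 / real CARD('p) \<le> 1" using prime_card_gt_1[where 'p='p] by simp
      then show "padic_norm (x - padic_of_rat q) \<le> 1" using q by linarith
    qed
    then show ?thesis by simp
  qed
  have eq: "padic_of_rat q * of_int b = (of_int a :: 'p padic)"
    using b unfolding qab by (simp flip: padic_of_rat_of_int padic_of_rat_mult)
  \<comment> \<open>Since a/b has norm at most 1, p dividing b would force p to divide a as well,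
    against coprimality.\<close>
  have nb: "\<not> ?p dvd b"
  proof
    assume "?p dvd b"
    then have b1: "padic_norm (of_int b :: 'p padic) \<le> real CARD('p) powi (- int 1)"
      by (subst padic_norm_of_int_le_iff) simp
    have "padic_norm (of_int a :: 'p padic) \<le> 1 * real CARD('p) powi (- int 1)"
      unfolding eq[symmetric] padic_norm_mult by (intro mult_mono q1 b1) auto
    then have "?p dvd a" by (simp only: mult_1 padic_norm_of_int_le_iff power_one_right)
    then show False using \<open>?p dvd b\<close> cop p not_coprimeI not_prime_unit by blast
  qed
  then have "coprime b ?p" using p nb by (metis coprime_commute prime_imp_coprime)
  then obtain c where c: "[b * c = 1] (mod ?p)" using cong_solve_coprime_int by blast
  define d where "d = nat ((a * c) mod ?p)"
  have d: "int d = (a * c) mod ?p" unfolding d_def using p by (simp add: prime_gt_0_int)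
  have "[int d * b = a * c * b] (mod ?p)" unfolding d by (intro cong_mult cong_refl) (simp add: cong_def)
  also have "[a * c * b = a * 1] (mod ?p)" using cong_mult[OF cong_refl c, of a] by (simp add: ac_simps)
  finally have dv: "?p dvd a - int d * b" by (simp add: cong_iff_dvd_diff dvd_diff_commute)
  have nrm_b: "padic_norm (of_int b :: 'p padic) = 1"
    using b nb by (subst padic_norm_of_int) (auto simp: not_dvd_imp_multiplicity_0)
  \<comment> \<open>Multiplication by the unit b preserves the norm and clears the denominator,
    leaving the integer a - d b, which is divisible by p.\<close>
  have "padic_norm (padic_of_rat q - of_nat d :: 'p padic) = padic_norm ((padic_of_rat q - of_nat d) * of_int b :: 'p padic)"
    by (simp add: padic_norm_mult nrm_b)
  also have "(padic_of_rat q - of_nat d) * of_int b = (of_int (a - int d * b) :: 'p padic)"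
    by (simp add: left_diff_distrib eq)
  also have "padic_norm \<dots> \<le> real CARD('p) powi (- int 1)"
    using dv by (simp only: padic_norm_of_int_le_iff power_one_right)
  finally have 1: "padic_norm (padic_of_rat q - of_nat d :: 'p padic) \<le> 1 / real CARD('p)"
    by (simp add: power_int_minus field_simps)
  show ?thesis
  proof
    have "int d < ?p" unfolding d using p by (simp add: prime_gt_0_int)
    then show "d < CARD('p)" by simp
    show "padic_norm (x - of_nat d) \<le> 1 / real CARD('p)"
      using padic_norm_add_le[OF less_imp_le[OF q] 1] by simp
  qed
qed

lemma padic_digit_scaled:
  fixes x :: "'p::prime_card padic"
  assumes "padic_norm x \<le> real CARD('p) powi (- k)"
  obtains d where "d < CARD('p)"
    "padic_norm (x - of_nat d * prime_pow k) \<le> real CARD('p) powi (- (k + 1))"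
proof -
  note p = prime_card_gt_1[where 'p='p]
  have "padic_norm (prime_pow (- k) * x) \<le> real CARD('p) powi 0"
    using assms unfolding padic_norm_prime_pow_mult_le_iff by simp
  then obtain d where d: "d < CARD('p)" "padic_norm (prime_pow (- k) * x - of_nat d) \<le> 1 / real CARD('p)"
    using padic_digit[of "prime_pow (- k) * x"] by auto
  have "prime_pow k * prime_pow (- k) = (1 :: 'p padic)"
    by (simp flip: prime_pow_add)
  then have "x - of_nat d * prime_pow k = prime_pow k * (prime_pow (- k) * x - of_nat d)"
    by (simp only: right_diff_distrib mult.assoc[symmetric] mult_1 mult.commute[of _ "of_nat d"])
  then have "padic_norm (x - of_nat d * prime_pow k) \<le> real CARD('p) powi (- (k + 1))"
    using d(2) p by (simp add: padic_norm_prime_pow_mult_le_iff power_int_minus inverse_eq_divide)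
  then show ?thesis using d(1) that by blast
qed

section \<open>Compactness and balls\<close>

instance padic :: (prime_card) complete_space
  by standard (rule padic_complete)

lemma padic_norm_eq_dist: "padic_norm x = dist 0 x"
  by (simp add: dist_padic_def)

text \<open>Induction on \<open>N\<close>: adding every possible next digit to every centre refines
  a net of mesh p^(-(k+N)) to one of mesh p^(-(k+N+1)), which is still finite.\<close>

lemma padic_finite_net:
  fixes k :: int
  shows "\<exists>C :: 'p::prime_card padic set. finite C \<and>
    (\<forall>x. padic_norm x \<le> real CARD('p) powi (- k) \<longrightarrow>
       (\<exists>c\<in>C. padic_norm (x - c) \<le> real CARD('p) powi (- (k + int N))))"
proof (induction N)
  case 0
  show ?case by (intro exI[of _ "{0}"]) simp
next
  case (Suc N)
  then obtain C :: "'p padic set" where C: "finite C"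
    "\<And>x. padic_norm x \<le> real CARD('p) powi (- k) \<Longrightarrow>
       \<exists>c\<in>C. padic_norm (x - c) \<le> real CARD('p) powi (- (k + int N))" by blast
  define D where "D = (\<lambda>(c, d). c + of_nat d * prime_pow (k + int N)) ` (C \<times> {..<CARD('p)})"
  have "\<exists>c\<in>D. padic_norm (x - c) \<le> real CARD('p) powi (- (k + int (Suc N)))"
    if x: "padic_norm x \<le> real CARD('p) powi (- k)" for x
  proof -
    obtain c where c: "c \<in> C" "padic_norm (x - c) \<le> real CARD('p) powi (- (k + int N))"
      using C(2)[OF x] by blast
    obtain d where d: "d < CARD('p)"
      "padic_norm (x - c - of_nat d * prime_pow (k + int N)) \<le> real CARD('p) powi (- (k + int N + 1))"
      using padic_digit_scaled[OF c(2)] by blast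
    show ?thesis
    proof (rule bexI)
      show "padic_norm (x - (c + of_nat d * prime_pow (k + int N))) \<le> real CARD('p) powi (- (k + int (Suc N)))"
        using d(2) by (simp only: diff_diff_eq of_nat_Suc add.assoc add.commute[of 1])
      show "c + of_nat d * prime_pow (k + int N) \<in> D"
        using c(1) d(1) unfolding D_def by force
    qed
  qed
  moreover have "finite D" unfolding D_def using C(1) by simp
  ultimately show ?case by blast
qed

lemma prime_card_powi_small:
  assumes "r > 0"
  obtains N :: nat where "real CARD('p::prime_card) powi (- int N) < r"
proof -
  obtain N where "(1 / real CARD('p)) ^ N < r"
    using real_arch_pow_inv[OF assms, of "1 / real CARD('p)"] prime_card_gt_1[where 'p='p] by auto
  then show ?thesis
    using that[of N] by (simp add: power_int_minus power_one_over inverse_eq_divide)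
qed

lemma prime_card_powi_mono:
  "k \<le> l \<Longrightarrow> real CARD('p::prime_card) powi k \<le> real CARD('p) powi l"
  using prime_card_gt_1[where 'p='p] by (intro power_int_increasing) auto

lemma compact_padic_cball:
  "compact {x :: 'p::prime_card padic. padic_norm x \<le> real CARD('p) powi (- k)}" (is "compact ?S")
  unfolding compact_eq_totally_bounded
proof (intro conjI allI impI)
  have "?S = cball 0 (real CARD('p) powi (- k))" by (auto simp: padic_norm_eq_dist)
  then show "complete ?S" by (simp add: complete_eq_closed)
next
  fix e :: real assume "e > 0"
  \<comment> \<open>Scaling the target by p^k makes the mesh p^(-(k+N)) of the net fall below
    e.\<close>
  then obtain N where N: "real CARD('p) powi (- int N) < e * real CARD('p) powi k"
    using prime_card_powi_small[of "e * real CARD('p) powi k", where 'p='p]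
      zero_less_power_int[of "real CARD('p)" k] prime_card_gt_1[where 'p='p] by auto
  have "real CARD('p) powi (- (k + int N)) = real CARD('p) powi (- k) * real CARD('p) powi (- int N)"
    using prime_card_gt_1[where 'p='p] by (subst power_int_add[symmetric]) auto
  also have "\<dots> < real CARD('p) powi (- k) * (e * real CARD('p) powi k)"
    using N prime_card_gt_1[where 'p='p] by (intro mult_strict_left_mono) auto
  also have "\<dots> = e"
    using prime_card_gt_1[where 'p='p] by (simp add: power_int_minus)
  finally have r: "real CARD('p) powi (- (k + int N)) < e" .
  obtain C :: "'p padic set" where C: "finite C"
    "\<And>x. padic_norm x \<le> real CARD('p) powi (- k) \<Longrightarrow>
       \<exists>c\<in>C. padic_norm (x - c) \<le> real CARD('p) powi (- (k + int N))"
    using padic_finite_net[of k N] by blast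
  have "?S \<subseteq> (\<Union>c\<in>C. ball c e)"
  proof
    fix x assume "x \<in> ?S"
    then obtain c where "c \<in> C" "padic_norm (x - c) \<le> real CARD('p) powi (- (k + int N))"
      using C(2) by blast
    then show "x \<in> (\<Union>c\<in>C. ball c e)"
      using r by (auto simp: dist_padic_def padic_norm_diff_commute[of _ x] intro!: bexI[of _ c])
  qed
  then show "\<exists>C. finite C \<and> ?S \<subseteq> (\<Union>c\<in>C. ball c e)" using C(1) by blast
qed

text \<open>A bounded sequence stays in some ball of radius p^N about 0, which is compact. The class
  passes to vectors, where compactness of balls then reduces to being bounded and closed.\<close>

instance padic :: (prime_card) heine_borel
proof
  fix f :: "nat \<Rightarrow> 'a padic"
  assume "bounded (range f)"
  then obtain r where r: "\<And>n. padic_norm (f n) \<le> r"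
    unfolding bounded_any_center[of _ 0] by (auto simp: padic_norm_eq_dist)
  obtain N where N: "real CARD('a) powi (- int N) < inverse (max r 1)"
    by (rule prime_card_powi_small[of "inverse (max r 1)", where 'p='a]) simp
  then have "max r 1 < real CARD('a) powi int N"
    using prime_card_gt_1[where 'p='a] by (simp add: power_int_minus)
  then have "\<forall>n. f n \<in> {x. padic_norm x \<le> real CARD('a) powi (- (- int N))}"
    by (auto intro: order_trans[OF r less_imp_le])
  moreover have "seq_compact {x :: 'a padic. padic_norm x \<le> real CARD('a) powi (- (- int N))}"
    using compact_padic_cball by (simp only: compact_eq_seq_compact_metric)
  ultimately show "\<exists>l r. strict_mono r \<and> (f \<circ> r) \<longlonglongrightarrow> l"
    unfolding seq_compact_def by blast
qed

section \<open>Ultrametric balls of radius p^(-k) in \<open>padic ^ 'n\<close>: a larger index means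
  a smaller ball\<close>

definition padic_ball :: "'p::prime_card padic ^ 'n \<Rightarrow> int \<Rightarrow> ('p padic ^ 'n) set" where
  "padic_ball a k = {x. \<forall>j. padic_norm (x $ j - a $ j) \<le> real CARD('p) powi (- k)}"

lemma padic_ball_self [simp, intro]: "a \<in> padic_ball a k"
  by (simp add: padic_ball_def)

lemma padic_ball_mono: "k \<le> l \<Longrightarrow> padic_ball (a :: 'p::prime_card padic ^ 'n) l \<subseteq> padic_ball a k"
  using prime_card_powi_mono[of "- l" "- k", where 'p='p]
  by (auto simp: padic_ball_def intro: order_trans)

lemma padic_ball_sym: "x \<in> padic_ball a k \<longleftrightarrow> a \<in> padic_ball x k"
  by (simp add: padic_ball_def padic_norm_diff_commute)

lemma padic_ball_trans: "x \<in> padic_ball y k \<Longrightarrow> y \<in> padic_ball z k \<Longrightarrow> x \<in> padic_ball z k"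
  unfolding padic_ball_def
  using padic_norm_add_le[of "x $ j - y $ j" _ "y $ j - z $ j" for j] by fastforce

text \<open>Every point of an ultrametric ball is a centre of it, so the balls of one radius
  partition the space.\<close>

lemma padic_ball_eqI: "x \<in> padic_ball a k \<Longrightarrow> padic_ball x k = padic_ball a k"
  using padic_ball_trans padic_ball_sym by blast

lemma padic_ball_eq_iff: "padic_ball x k = padic_ball a k \<longleftrightarrow> x \<in> padic_ball a k"
  using padic_ball_eqI padic_ball_self by blast

lemma padic_ball_disjoint: "padic_ball x k \<noteq> padic_ball y k \<Longrightarrow> padic_ball x k \<inter> padic_ball y k = {}"
  using padic_ball_eqI by blast

lemma padic_ball_subset:
  assumes "k \<le> l" "x \<in> padic_ball a k"
  shows "padic_ball x l \<subseteq> padic_ball a k"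
  using padic_ball_mono[OF assms(1), of x] padic_ball_eqI[OF assms(2)] by simp

lemma padic_ball_add_iff [simp]: "c + x \<in> padic_ball (c + a) k \<longleftrightarrow> x \<in> padic_ball a k"
  by (simp add: padic_ball_def)

lemma padic_ball_iff_diff: "x \<in> padic_ball a k \<longleftrightarrow> x - a \<in> padic_ball 0 k"
  by (simp add: padic_ball_def)

lemma padic_ball_minus_iff: "- x \<in> padic_ball a k \<longleftrightarrow> x \<in> padic_ball (- a) k"
proof -
  have "padic_norm (- (x $ j) - a $ j) = padic_norm (x $ j + a $ j)" for j
    using padic_norm_minus[of "x $ j + a $ j"] by simp
  then show ?thesis by (simp add: padic_ball_def)
qed

lemma padic_ball_prime_pow_iff:
  "(prime_pow l :: 'p::prime_card padic) *s x \<in> padic_ball 0 k \<longleftrightarrow> x \<in> padic_ball 0 (k - l)"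
  by (simp add: padic_ball_def padic_norm_prime_pow_mult_le_iff)

lemma padic_integer_vecs_eq_ball: "padic_integer_vecs = padic_ball 0 0"
  by (simp add: padic_integer_vecs_def padic_integers_def padic_ball_def)

lemma open_padic_ball: "open (padic_ball (a :: 'p::prime_card padic ^ 'n) k)"
proof -
  have 1: "open {y :: 'p padic. padic_norm (y - c) \<le> real CARD('p) powi (- k)}" for c
    unfolding open_dist
  proof (intro ballI exI conjI allI impI)
    show "0 < real CARD('p) powi (- k)" using prime_card_gt_1[where 'p='p] by simp
    fix x y :: "'p padic"
    assume "x \<in> {y. padic_norm (y - c) \<le> real CARD('p) powi (- k)}" "dist y x < real CARD('p) powi (- k)"
    then show "y \<in> {y. padic_norm (y - c) \<le> real CARD('p) powi (- k)}"
      using padic_norm_add_le[of "y - x" "real CARD('p) powi (- k)" "x - c"] by (simp add: dist_padic_def)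
  qed
  have "padic_ball a k = {x. \<forall>j. x $ j \<in> {y. padic_norm (y - a $ j) \<le> real CARD('p) powi (- k)}}"
    by (simp add: padic_ball_def)
  then show ?thesis using open_vector_box[of "\<lambda>j. {y. padic_norm (y - a $ j) \<le> real CARD('p) powi (- k)}"] 1 by simp
qed

text \<open>The complement is a union of balls of the same radius, hence open.\<close>

lemma closed_padic_ball: "closed (padic_ball (a :: 'p::prime_card padic ^ 'n) k)"
proof -
  have "- padic_ball a k = (\<Union>x\<in>- padic_ball a k. padic_ball x k)"
    using padic_ball_sym padic_ball_trans by blast
  then have "open (- padic_ball a k)" using open_padic_ball by (metis open_UN)
  then show ?thesis by (simp add: closed_def)
qed

lemma compact_padic_ball: "compact (padic_ball (a :: 'p::prime_card padic ^ 'n) k)"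
  unfolding compact_eq_bounded_closed
proof
  have "dist a x \<le> (\<Sum>j\<in>(UNIV :: 'n set). real CARD('p) powi (- k))" if "x \<in> padic_ball a k" for x
  proof -
    \<comment> \<open>The distance on vectors is the Euclidean combination of the coordinate
      distances, whereas balls are defined coordinatewise; the sum of the distances mediates between
      the two.\<close>
    have "dist a x \<le> (\<Sum>j\<in>UNIV. dist (a $ j) (x $ j))"
      unfolding dist_vec_def by (rule L2_set_le_sum) simp
    also have "\<dots> \<le> (\<Sum>j\<in>(UNIV :: 'n set). real CARD('p) powi (- k))"
      using that by (intro sum_mono) (simp add: padic_ball_def dist_padic_def padic_norm_diff_commute)
    finally show ?thesis .
  qed
  then show "bounded (padic_ball a k)" unfolding bounded_def by blast
qed (rule closed_padic_ball)

lemma open_contains_padic_ball: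
  fixes U :: "('p::prime_card padic ^ 'n) set"
  assumes "open U" "x \<in> U"
  obtains k :: nat where "padic_ball x (int k) \<subseteq> U"
proof -
  obtain e where e: "e > 0" "\<And>y. dist y x < e \<Longrightarrow> y \<in> U"
    using assms unfolding open_dist by blast
  then have "e / real CARD('n) > 0" by simp
  then obtain N where N: "real CARD('p) powi (- int N) < e / real CARD('n)"
    by (rule prime_card_powi_small)
  have "y \<in> U" if "y \<in> padic_ball x (int N)" for y
  proof (rule e(2))
    have "dist y x \<le> (\<Sum>j\<in>UNIV. dist (y $ j) (x $ j))"
      unfolding dist_vec_def by (rule L2_set_le_sum) simp
    also have "\<dots> \<le> (\<Sum>j\<in>(UNIV :: 'n set). real CARD('p) powi (- int N))"
      using that by (intro sum_mono) (simp add: padic_ball_def dist_padic_def)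
    also have "\<dots> < e" using N by (simp add: field_simps)
    finally show "dist y x < e" .
  qed
  then show ?thesis using that by blast
qed

text \<open>A Lebesgue number argument: a finite subcover has a largest exponent \<open>N\<close>,
  and any ball of that radius or smaller centred in \<open>K\<close> lies inside a member of the
  subcover. It is applied with \<open>P\<close> saying that a set lies in \<open>K\<close>, and that
  a function is constant on it.\<close>

lemma compact_padic_ball_uniform:
  fixes K :: "('p::prime_card padic ^ 'n) set"
  assumes K: "compact K"
    and P: "\<And>x. x \<in> K \<Longrightarrow> \<exists>k. P (padic_ball x k)"
    and mono: "\<And>S T. P S \<Longrightarrow> T \<subseteq> S \<Longrightarrow> P T"
  obtains N where "\<And>l x. l \<ge> N \<Longrightarrow> x \<in> K \<Longrightarrow> P (padic_ball x l)"
proof -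
  obtain k where k: "\<And>x. x \<in> K \<Longrightarrow> P (padic_ball x (k x))" using P by metis
  have "K \<subseteq> (\<Union>x\<in>K. padic_ball x (k x))" by auto
  then obtain C where C: "C \<subseteq> K" "finite C" "K \<subseteq> (\<Union>x\<in>C. padic_ball x (k x))"
    using compactE_image[OF K, of K "\<lambda>x. padic_ball x (k x)"] open_padic_ball by metis
  \<comment> \<open>Inserting 0 keeps the maximum meaningful when the subcover is empty.\<close>
  define N where "N = Max (insert 0 (k ` C))"
  have "P (padic_ball x l)" if l: "l \<ge> N" and x: "x \<in> K" for l x
  proof -
    obtain c where c: "c \<in> C" "x \<in> padic_ball c (k c)" using C(3) x by blast
    have "k c \<le> N" unfolding N_def using C(2) c(1) by (intro Max_ge) auto
    then have "padic_ball x l \<subseteq> padic_ball c (k c)" using l c(2) by (intro padic_ball_subset) auto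
    then show ?thesis using mono k c(1) C(1) by blast
  qed
  then show ?thesis using that by blast
qed

lemma finite_padic_balls:
  assumes "compact K"
  shows "finite ((\<lambda>x. padic_ball x k) ` K)"
proof -
  have "K \<subseteq> (\<Union>x\<in>K. padic_ball x k)" by auto
  then obtain C where C: "C \<subseteq> K" "finite C" "K \<subseteq> (\<Union>x\<in>C. padic_ball x k)"
    using compactE_image[OF assms, of K "\<lambda>x. padic_ball x k"] open_padic_ball by metis
  have "(\<lambda>x. padic_ball x k) ` K \<subseteq> (\<lambda>x. padic_ball x k) ` C"
  proof (rule image_subsetI)
    fix x assume "x \<in> K"
    then obtain c where "c \<in> C" "x \<in> padic_ball c k" using C(3) by auto
    then show "padic_ball x k \<in> (\<lambda>x. padic_ball x k) ` C"
      using padic_ball_eqI by (intro image_eqI[of _ _ c]) auto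
  qed
  then show ?thesis using C(2) finite_subset by blast
qed

section \<open>Subdivision of a ball into p^n balls of the next smaller radius\<close>

definition subball_center :: "'p::prime_card padic ^ 'n \<Rightarrow> int \<Rightarrow> ('n \<Rightarrow> nat) \<Rightarrow> 'p padic ^ 'n" where
  "subball_center a k d = (\<chi> j. a $ j + of_nat (d j) * prime_pow k)"

text \<open>The \<open>itself\<close> argument carries the prime, which the type of the digit
  vectors does not determine.\<close>

abbreviation digit_vecs :: "'p::prime_card itself \<Rightarrow> ('n \<Rightarrow> nat) set" where
  "digit_vecs _ \<equiv> UNIV \<rightarrow>\<^sub>E {..<CARD('p)}"

lemma padic_ball_subdivide:
  "padic_ball (a :: 'p::prime_card padic ^ 'n) k =
     (\<Union>d\<in>digit_vecs TYPE('p). padic_ball (subball_center a k d) (k + 1))"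
proof (intro equalityI subsetI)
  fix x assume "x \<in> padic_ball a k"
  then have "\<exists>d<CARD('p). padic_norm (x $ j - a $ j - of_nat d * prime_pow k) \<le> real CARD('p) powi (- (k + 1))" for j
    unfolding padic_ball_def using padic_digit_scaled[of "x $ j - a $ j" k] by blast
  then obtain d where d: "\<And>j. d j < CARD('p)"
    "\<And>j. padic_norm (x $ j - a $ j - of_nat (d j) * prime_pow k) \<le> real CARD('p) powi (- (k + 1))"
    by metis
  then have "x \<in> padic_ball (subball_center a k d) (k + 1)" "d \<in> digit_vecs TYPE('p)"
    by (auto simp: padic_ball_def subball_center_def diff_diff_eq)
  then show "x \<in> (\<Union>d\<in>digit_vecs TYPE('p). padic_ball (subball_center a k d) (k + 1))" by blast
next
  fix x assume "x \<in> (\<Union>d\<in>digit_vecs TYPE('p). padic_ball (subball_center a k d) (k + 1))"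
  then obtain d where d: "x \<in> padic_ball (subball_center a k d) (k + 1)" by blast
  have "padic_norm (of_nat (d j) * prime_pow k :: 'p padic) \<le> 1 * real CARD('p) powi (- k)" for j
    unfolding padic_norm_mult padic_norm_prime_pow
    using padic_norm_of_int_le_1[of "int (d j)", where 'p='p] by (intro mult_right_mono) auto
  then have "subball_center a k d \<in> padic_ball a k"
    by (simp add: padic_ball_def subball_center_def)
  then show "x \<in> padic_ball a k" using padic_ball_subset[of k "k + 1" "subball_center a k d" a] d by auto
qed

text \<open>If two subballs coincide, their digits agree modulo p in every coordinate, and digits
  lie below p.\<close>

lemma inj_on_subball:
  "inj_on (\<lambda>d. padic_ball (subball_center (a :: 'p::prime_card padic ^ 'n) k d) (k + 1)) (digit_vecs TYPE('p))"
proof (rule inj_onI)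
  fix d e :: "'n \<Rightarrow> nat"
  assume d: "d \<in> digit_vecs TYPE('p)" and e: "e \<in> digit_vecs TYPE('p)"
    and "padic_ball (subball_center a k d) (k + 1) = padic_ball (subball_center a k e) (k + 1)"
  then have "subball_center a k d \<in> padic_ball (subball_center a k e) (k + 1)"
    by (simp add: padic_ball_eq_iff)
  then have *: "padic_norm (of_nat (d j) * prime_pow k - of_nat (e j) * prime_pow k :: 'p padic) \<le> real CARD('p) powi (- (k + 1))" for j
    by (simp add: padic_ball_def subball_center_def)
  show "d = e"
  proof
    fix j
    have "of_nat (d j) * prime_pow k - of_nat (e j) * prime_pow k = (prime_pow k * of_int (int (d j) - int (e j)) :: 'p padic)"
      by (simp only: of_int_diff of_int_of_nat_eq right_diff_distrib mult.commute[of "prime_pow k"])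
    then have "padic_norm (of_int (int (d j) - int (e j)) :: 'p padic) \<le> real CARD('p) powi (- int 1)"
      using *[of j] by (simp only: padic_norm_prime_pow_mult_le_iff) simp
    then have "int CARD('p) dvd int (d j) - int (e j)"
      by (simp only: padic_norm_of_int_le_iff power_one_right)
    moreover have "d j < CARD('p)" "e j < CARD('p)" using d e by auto
    ultimately show "d j = e j"
      by (metis mod_eq_dvd_iff mod_pos_pos_trivial of_nat_0_le_iff of_nat_eq_iff of_nat_less_iff)
  qed
qed

lemma finite_digit_vecs: "finite (digit_vecs TYPE('p::prime_card) :: ('n::finite \<Rightarrow> nat) set)"
  by (intro finite_PiE) auto

lemma card_digit_vecs: "card (digit_vecs TYPE('p::prime_card) :: ('n::finite \<Rightarrow> nat) set) = CARD('p) ^ CARD('n)"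
  by (simp add: card_PiE)

section \<open>Characters\<close>

text \<open>
  The fractional part is determined modulo \<open>\<int>\<close> by any approximation \<open>m / p\<^sup>N\<close> of \<open>y\<close> up to
  \<open>\<int>\<^sub>p\<close>. Working with such approximations gives additivity of the fractional part modulo \<open>\<int>\<close> and avoids
  both the uniqueness of digit expansions and the carries in adding them.
\<close>

definition padic_frac_rep :: "'p::prime_card padic \<Rightarrow> real \<Rightarrow> bool" where
  "padic_frac_rep y r \<longleftrightarrow> (\<exists>m N. r = real_of_int m / real CARD('p) ^ N \<and>
     padic_norm (y - of_int m * prime_pow (- int N)) \<le> 1)"

lemma of_int_prime_pow_diff:
  "of_int m * prime_pow (- int M) - of_int n * prime_pow (- int N)
    = (prime_pow (- int (M + N)) * of_int (m * int CARD('p) ^ N - n * int CARD('p) ^ M) :: 'p::prime_card padic)"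
proof -
  have *: "(prime_pow (- int K) :: 'p padic) = inverse (of_nat CARD('p) ^ K)" for K
    by (simp add: power_int_minus)
  show ?thesis unfolding * by (simp add: field_simps power_add)
qed

text \<open>Over the common denominator p^(M+N) the numerators differ by an integer \<open>c\<close>
  of norm at most p^(-(M+N)), so the denominator divides \<open>c\<close>.\<close>

lemma padic_frac_rep_unique:
  fixes y :: "'p::prime_card padic"
  assumes "padic_frac_rep y r" "padic_frac_rep y s"
  shows "r - s \<in> \<int>"
proof -
  note p = prime_card_gt_1[where 'p='p]
  obtain m M where m: "r = real_of_int m / real CARD('p) ^ M"
    "padic_norm (y - of_int m * prime_pow (- int M)) \<le> 1"
    using assms(1) unfolding padic_frac_rep_def by blast
  obtain n N where n: "s = real_of_int n / real CARD('p) ^ N"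
    "padic_norm (y - of_int n * prime_pow (- int N)) \<le> 1"
    using assms(2) unfolding padic_frac_rep_def by blast
  define c where "c = m * int CARD('p) ^ N - n * int CARD('p) ^ M"
  have "padic_norm (of_int m * prime_pow (- int M) - of_int n * prime_pow (- int N) :: 'p padic) \<le> real CARD('p) powi 0"
    using padic_norm_diff_le[OF n(2) m(2)] by simp
  then have "padic_norm (of_int c :: 'p padic) \<le> real CARD('p) powi (- int (M + N))"
    unfolding of_int_prime_pow_diff padic_norm_prime_pow_mult_le_iff c_def by simp
  then have "int CARD('p) ^ (M + N) dvd c" by (simp only: padic_norm_of_int_le_iff)
  then obtain e where e: "c = int CARD('p) ^ (M + N) * e" by blast
  have "r - s = real_of_int c / real CARD('p) ^ (M + N)"
    using p by (simp add: m n c_def field_simps power_add)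
  also have "\<dots> = real_of_int e" using p unfolding e by simp
  finally show ?thesis by simp
qed

lemma padic_frac_rep_add:
  fixes x y :: "'p::prime_card padic"
  assumes "padic_frac_rep x r" "padic_frac_rep y s"
  shows "padic_frac_rep (x + y) (r + s)"
proof -
  note p = prime_card_gt_1[where 'p='p]
  obtain m M where m: "r = real_of_int m / real CARD('p) ^ M"
    "padic_norm (x - of_int m * prime_pow (- int M)) \<le> 1"
    using assms(1) unfolding padic_frac_rep_def by blast
  obtain n N where n: "s = real_of_int n / real CARD('p) ^ N"
    "padic_norm (y - of_int n * prime_pow (- int N)) \<le> 1"
    using assms(2) unfolding padic_frac_rep_def by blast
  define c where "c = m * int CARD('p) ^ N + n * int CARD('p) ^ M"
  have eq: "of_int m * prime_pow (- int M) + of_int n * prime_pow (- int N)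
     = (of_int c * prime_pow (- int (M + N)) :: 'p padic)"
    using of_int_prime_pow_diff[of m M "- n" N, where 'p='p] by (simp add: c_def mult.commute)
  have "padic_norm ((x - of_int m * prime_pow (- int M)) + (y - of_int n * prime_pow (- int N))) \<le> 1"
    by (rule padic_norm_add_le[OF m(2) n(2)])
  then have "padic_norm (x + y - of_int c * prime_pow (- int (M + N))) \<le> 1"
    by (simp only: eq[symmetric] add_diff_add)
  moreover have "r + s = real_of_int c / real CARD('p) ^ (M + N)"
    using p by (simp add: m n c_def field_simps power_add)
  ultimately show ?thesis unfolding padic_frac_rep_def by blast
qed

lemma padic_norm_sum_le:
  assumes "\<And>i. i \<in> I \<Longrightarrow> padic_norm (f i) \<le> r" "r \<ge> 0"
  shows "padic_norm (sum f I) \<le> r"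
  using assms by (induction I rule: infinite_finite_induct) (auto intro: padic_norm_add_le)

lemma digit_sum_less:
  assumes "\<And>i. d i < p"
  shows "(\<Sum>i<n. d i * p ^ i) < (p :: nat) ^ n"
proof (induction n)
  case (Suc n)
  have "Suc (d n) * p ^ n \<le> p * p ^ n" using assms[of n] by (intro mult_right_mono) auto
  then show ?case using Suc by simp
qed simp

text \<open>The terms with nonnegative exponent form a tail of norm at most 1, so the truncated sum
  approximates \<open>y\<close> up to a p-adic integer. Read as a real number it is a numerator
  below p^N divided by p^N.\<close>

lemma padic_frac_rep_digits:
  fixes y :: "'p::prime_card padic"
  assumes k: "k < 0" and d: "\<And>i. d i < CARD('p)"
    and s: "(\<lambda>i. of_nat (d i) * prime_pow (k + int i)) sums y"
    and r: "r = (\<Sum>i<nat (- k). real (d i) * real CARD('p) powi (k + int i))"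
  shows "padic_frac_rep y r" "0 \<le> r" "r < 1"
proof -
  note p = prime_card_gt_1[where 'p='p]
  define N where "N = nat (- k)"
  have N: "k = - int N" using k by (simp add: N_def)
  define m where "m = (\<Sum>i<N. d i * CARD('p) ^ i)"
  have pow: "real CARD('p) powi (k + int i) = real CARD('p) ^ i / real CARD('p) ^ N" for i
    using p unfolding N by (simp only: uminus_add_conv_diff) (simp add: power_int_diff)
  have r': "r = real m / real CARD('p) ^ N"
    unfolding r N_def[symmetric] pow m_def by (simp add: sum_divide_distrib)
  show "0 \<le> r" using r' by simp
  have "m < CARD('p) ^ N" unfolding m_def by (rule digit_sum_less[OF d])
  then show "r < 1" using p unfolding r' by (simp flip: of_nat_power)
  let ?S = "\<lambda>n. \<Sum>i<n. of_nat (d i) * prime_pow (k + int i) :: 'p padic"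
  have S: "?S N = of_nat m * prime_pow (- int N)"
    unfolding m_def N by (simp add: prime_pow_add sum_distrib_left mult_ac del: uminus_add_conv_diff)
  have tail: "padic_norm (?S n - ?S N) \<le> 1" if "n \<ge> N" for n
  proof -
    have "?S n - ?S N = (\<Sum>i\<in>{N..<n}. of_nat (d i) * prime_pow (k + int i))"
      using that by (metis (no_types, lifting) sum_diff_nat_ivl atLeast0LessThan zero_le)
    also have "padic_norm \<dots> \<le> 1"
    proof (rule padic_norm_sum_le)
      fix i assume i: "i \<in> {N..<n}"
      have "padic_norm (of_nat (d i) * prime_pow (k + int i) :: 'p padic) \<le> 1 * real CARD('p) powi 0"
        unfolding padic_norm_mult padic_norm_prime_pow
        using padic_norm_of_int_le_1[of "int (d i)", where 'p='p] i
        by (intro mult_mono prime_card_powi_mono) (auto simp: N)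
      then show "padic_norm (of_nat (d i) * prime_pow (k + int i) :: 'p padic) \<le> 1" by simp
    qed simp
    finally show ?thesis .
  qed
  have "?S \<longlonglongrightarrow> y" using s by (simp add: sums_def)
  then obtain M where M: "\<And>n. n \<ge> M \<Longrightarrow> dist (?S n) y < 1"
    unfolding lim_sequentially using zero_less_one by blast
  \<comment> \<open>A partial sum that is both past the truncation and within distance 1 of the
    limit connects the truncated sum with \<open>y\<close>.\<close>
  have "padic_norm ((?S (max M N) - ?S N) - (?S (max M N) - y)) \<le> 1"
    using tail[of "max M N"] M[of "max M N"]
    by (intro padic_norm_diff_le[of "?S (max M N) - ?S N" 1 "?S (max M N) - y"]) (auto simp: dist_padic_def)
  then have "padic_norm (y - of_int (int m) * prime_pow (- int N)) \<le> 1"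
    by (simp add: S)
  then show "padic_frac_rep y r"
    unfolding padic_frac_rep_def using r' by (intro exI[of _ "int m"] exI[of _ N]) simp
qed

text \<open>The digits are found greedily: \<open>f n\<close> is the remainder after n digits, and
  its norm is at most p^(-(k+n)), so the remainders tend to 0.\<close>

lemma padic_expansion:
  fixes y :: "'p::prime_card padic"
  assumes "padic_norm y \<le> real CARD('p) powi (- k)"
  obtains d where "\<And>i. d i < CARD('p)" "(\<lambda>i. of_nat (d i) * prime_pow (k + int i)) sums y"
proof -
  note p = prime_card_gt_1[where 'p='p]
  have "\<exists>f. \<forall>n. (padic_norm (f n) \<le> real CARD('p) powi (- (k + int n)) \<and> (n = 0 \<longrightarrow> f n = y)) \<and>
      (\<exists>d<CARD('p). f (Suc n) = f n - of_nat d * prime_pow (k + int n))"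
  proof (rule dependent_nat_choice)
    show "\<exists>x. padic_norm x \<le> real CARD('p) powi (- (k + int 0)) \<and> ((0::nat) = 0 \<longrightarrow> x = y)"
      using assms by simp
  next
    fix x n
    assume "padic_norm x \<le> real CARD('p) powi (- (k + int n)) \<and> (n = 0 \<longrightarrow> x = y)"
    then obtain d where "d < CARD('p)"
      "padic_norm (x - of_nat d * prime_pow (k + int n)) \<le> real CARD('p) powi (- (k + int n + 1))"
      using padic_digit_scaled[of x "k + int n"] by blast
    moreover have "k + int n + 1 = k + int (Suc n)" by simp
    ultimately show "\<exists>z. (padic_norm z \<le> real CARD('p) powi (- (k + int (Suc n))) \<and> (Suc n = 0 \<longrightarrow> z = y)) \<and>
        (\<exists>d<CARD('p). z = x - of_nat d * prime_pow (k + int n))"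
      by (metis nat.distinct(1))
  qed
  then obtain f where f: "\<And>n. padic_norm (f n) \<le> real CARD('p) powi (- (k + int n))" "f 0 = y"
    "\<And>n. \<exists>d<CARD('p). f (Suc n) = f n - of_nat d * prime_pow (k + int n)" by blast
  obtain d where d: "\<And>n. d n < CARD('p)" "\<And>n. f (Suc n) = f n - of_nat (d n) * prime_pow (k + int n)"
    using f(3) by metis
  have part: "(\<Sum>i<n. of_nat (d i) * prime_pow (k + int i)) = y - f n" for n
    by (induction n) (simp_all add: f(2) d(2))
  have "(\<lambda>n. \<Sum>i<n. of_nat (d i) * prime_pow (k + int i)) \<longlonglongrightarrow> y"
    unfolding lim_sequentially part
  proof (intro allI impI)
    fix r :: real assume "r > 0"
    then obtain N where N: "real CARD('p) powi (- int N) < r" by (rule prime_card_powi_small)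
    have "dist (y - f n) y < r" if "n \<ge> N + nat (- k)" for n
    proof -
      have "dist (y - f n) y \<le> real CARD('p) powi (- (k + int n))" using f(1) by (simp add: dist_padic_def)
      also have "\<dots> \<le> real CARD('p) powi (- int N)" using that by (intro prime_card_powi_mono) auto
      finally show ?thesis using N by linarith
    qed
    then show "\<exists>N. \<forall>n\<ge>N. dist (y - f n) y < r" by blast
  qed
  then show ?thesis using that[of d] d(1) by (simp add: sums_def)
qed

text \<open>This resolves the definite description in \<open>padic_frac\<close>. Existence comes
  from an expansion starting at the exact order of \<open>y\<close>; what is proved unique is the
  value r rather than the digit sequence.\<close>

lemma padic_frac_rep_padic_frac: "padic_frac_rep y (padic_frac (y :: 'p::prime_card padic))"
proof (cases "y \<in> padic_integers")
  case True
  then have "padic_norm (y - of_int 0 * prime_pow (- int 0)) \<le> 1"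
    by (simp add: padic_integers_def)
  moreover have "padic_frac y = real_of_int 0 / real CARD('p) ^ 0"
    using True by (simp add: padic_frac_def)
  ultimately show ?thesis unfolding padic_frac_rep_def by blast
next
  case False
  note p = prime_card_gt_1[where 'p='p]
  define P where "P r \<longleftrightarrow> (\<exists>(k::int) (d::nat \<Rightarrow> nat). k < 0 \<and> (\<forall>i. d i < CARD('p)) \<and> d 0 \<noteq> 0 \<and>
        (\<lambda>i. of_nat (d i) * prime_pow (k + int i)) sums y \<and>
        r = (\<Sum>i<nat (- k). real (d i) * real CARD('p) powi (k + int i)))" for r
  have P: "padic_frac_rep y r \<and> 0 \<le> r \<and> r < 1" if Pr: "P r" for r
  proof -
    obtain k d where "k < 0" "\<And>i. d i < CARD('p)"
      "(\<lambda>i. of_nat (d i) * prime_pow (k + int i)) sums y"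
      "r = (\<Sum>i<nat (- k). real (d i) * real CARD('p) powi (k + int i))"
      using Pr unfolding P_def by blast
    then show ?thesis using padic_frac_rep_digits[of k d y r] by simp
  qed
  have y: "padic_norm y > 1" using False by (simp add: padic_integers_def)
  then have "y \<noteq> 0" by auto
  then obtain l where l: "padic_norm y = real CARD('p) powi l" by (rule padic_norm_prime_card_power)
  have "l > 0" using y prime_card_powi_mono[of l 0, where 'p='p] unfolding l by (cases "l > 0") auto
  have "padic_norm y \<le> real CARD('p) powi (- (- l))" using l by simp
  then obtain d where d: "\<And>i. d i < CARD('p)" "(\<lambda>i. of_nat (d i) * prime_pow (- l + int i)) sums y"
    by (rule padic_expansion) blast
  \<comment> \<open>With leading digit 0 all partial sums have norm at most p^(l-1), and so would
    \<open>y\<close>, whose norm is p^l.\<close>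
  have "d 0 \<noteq> 0"
  proof
    assume d0: "d 0 = 0"
    let ?S = "\<lambda>n. \<Sum>i<n. of_nat (d i) * prime_pow (- l + int i) :: 'p padic"
    have pos: "real CARD('p) powi l > 0" using p by simp
    have "?S \<longlonglongrightarrow> y" using d(2) by (simp add: sums_def)
    then obtain M where M: "\<And>n. n \<ge> M \<Longrightarrow> dist (?S n) y < real CARD('p) powi l"
      unfolding lim_sequentially using pos by blast
    have less: "real CARD('p) powi (l - 1) < real CARD('p) powi l" using p by (intro power_int_strict_increasing) auto
    have "padic_norm (?S M) \<le> real CARD('p) powi (l - 1)"
    proof (rule padic_norm_sum_le)
      fix i assume i: "i \<in> {..<M}"
      show "padic_norm (of_nat (d i) * prime_pow (- l + int i) :: 'p padic) \<le> real CARD('p) powi (l - 1)"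
      proof (cases "i = 0")
        case True
        then show ?thesis using d0 p by simp
      next
        case False
        have "padic_norm (of_nat (d i) * prime_pow (- l + int i) :: 'p padic) \<le> 1 * real CARD('p) powi (l - 1)"
          unfolding padic_norm_mult padic_norm_prime_pow
          using padic_norm_of_int_le_1[of "int (d i)", where 'p='p] False
          by (intro mult_mono prime_card_powi_mono) auto
        then show ?thesis by simp
      qed
    qed (use p in simp)
    moreover have "padic_norm y \<le> max (padic_norm (?S M)) (dist (?S M) y)"
      using padic_norm_diff_le[of "?S M" "max (padic_norm (?S M)) (dist (?S M) y)" "?S M - y"]
      by (simp add: dist_padic_def)
    ultimately show False using M[of M] less l by simp
  qed
  then have ex: "\<exists>r. P r" unfolding P_def using \<open>l > 0\<close> d by (intro exI[of _ "- l"] exI[of _ d] exI) auto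
  \<comment> \<open>Two candidates approximate the same \<open>y\<close>, hence differ by an
    integer, and both lie in [0,1).\<close>
  have uniq: "r = s" if "P r" "P s" for r s
  proof -
    have "r - s \<in> \<int>" using padic_frac_rep_unique P[OF that(1)] P[OF that(2)] by blast
    then obtain c where "r - s = of_int c" by (elim Ints_cases)
    moreover have "\<bar>r - s\<bar> < 1" using P[OF that(1)] P[OF that(2)] by linarith
    ultimately have "\<bar>real_of_int c\<bar> < 1" by simp
    then have "c = 0" by linarith
    then show ?thesis using \<open>r - s = of_int c\<close> by simp
  qed
  have "P (THE r. P r)" using ex uniq by (metis theI)
  moreover have "padic_frac y = (THE r. P r)" using False by (simp add: padic_frac_def P_def)
  ultimately show ?thesis using P by simp
qed

lemma padic_frac_add: "padic_frac (x + y) - (padic_frac x + padic_frac y) \<in> \<int>"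
  by (intro padic_frac_rep_unique[of "x + y"] padic_frac_rep_add padic_frac_rep_padic_frac)

section \<open>Bilinearity, triviality on dual balls and nontriviality of the character\<close>

lemma exp_2pi_cong:
  assumes "r - s \<in> \<int>"
  shows "exp (2 * of_real pi * \<i> * of_real r) = (exp (2 * of_real pi * \<i> * of_real s) :: complex)"
proof -
  obtain c where c: "r = s + of_int c" using assms by (elim Ints_cases) (simp add: algebra_simps)
  have "exp (2 * of_real pi * \<i> * of_real r) = exp (2 * of_real pi * \<i> * of_real s) * (exp ((2 * of_int c * of_real pi) * \<i>) :: complex)"
    unfolding c exp_add[symmetric] by (simp add: algebra_simps)
  also have "exp ((2 * of_int c * of_real pi) * \<i>) = (1 :: complex)"
    using exp_integer_2pi[of "of_int c"] by (simp add: mult_ac)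
  finally show ?thesis by simp
qed

lemma padic_char_add_left: "padic_char (\<xi> + \<zeta>) x = padic_char \<xi> x * padic_char \<zeta> x"
proof -
  have "(\<Sum>j\<in>UNIV. padic_frac ((\<xi> + \<zeta>) $ j * x $ j)) - ((\<Sum>j\<in>UNIV. padic_frac (\<xi> $ j * x $ j)) + (\<Sum>j\<in>UNIV. padic_frac (\<zeta> $ j * x $ j)))
     = (\<Sum>j\<in>UNIV. padic_frac (\<xi> $ j * x $ j + \<zeta> $ j * x $ j) - (padic_frac (\<xi> $ j * x $ j) + padic_frac (\<zeta> $ j * x $ j)))"
    by (simp add: sum.distrib sum_subtractf distrib_right)
  also have "\<dots> \<in> \<int>" by (rule Ints_sum) (rule padic_frac_add)
  finally show ?thesis
    unfolding padic_char_def by (subst exp_2pi_cong) (auto simp: exp_add[symmetric] distrib_left)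
qed

lemma padic_char_commute: "padic_char \<xi> x = padic_char x \<xi>"
  by (simp add: padic_char_def mult.commute)

lemma padic_char_add_right: "padic_char \<xi> (x + y) = padic_char \<xi> x * padic_char \<xi> y"
  by (simp add: padic_char_commute[of \<xi>] padic_char_add_left)

lemma padic_char_minus: "padic_char (- \<xi>) x = padic_char \<xi> (- x)"
  by (simp add: padic_char_def)

lemma padic_char_scale: "padic_char (c *s \<xi>) x = padic_char \<xi> (c *s x)"
  by (simp add: padic_char_def mult_ac)

lemma padic_char_0 [simp]: "padic_char 0 x = 1" "padic_char \<xi> 0 = 1"
  by (simp_all add: padic_char_def padic_frac_def padic_integers_def)

lemma padic_char_nonzero [simp]: "padic_char \<xi> x \<noteq> 0"
  by (simp add: padic_char_def)

lemma norm_padic_char [simp]: "norm (padic_char \<xi> x) = 1"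
  by (simp add: padic_char_def)

lemma padic_char_minus_mult: "padic_char \<xi> x * padic_char (- \<xi>) x = 1" "padic_char \<xi> x * padic_char \<xi> (- x) = 1"
  by (simp_all flip: padic_char_add_left padic_char_add_right)

text \<open>Balls about 0 of reciprocal radii are dual to each other: every product of coordinates
  is a p-adic integer.\<close>

lemma padic_char_eq_1:
  assumes "\<zeta> \<in> padic_ball 0 (- k)" "x \<in> padic_ball 0 k"
  shows "padic_char \<zeta> (x :: 'p::prime_card padic ^ 'n) = 1"
proof -
  have "padic_norm (\<zeta> $ j * x $ j) \<le> 1" for j
  proof -
    have "padic_norm (\<zeta> $ j * x $ j) \<le> real CARD('p) powi k * real CARD('p) powi (- k)"
      unfolding padic_norm_mult using assms by (intro mult_mono) (auto simp: padic_ball_def)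
    then show ?thesis using prime_card_gt_1[where 'p='p] by (simp add: power_int_minus)
  qed
  then show ?thesis by (simp add: padic_char_def padic_frac_def padic_integers_def)
qed

text \<open>If coordinate j of \<open>\<zeta>\<close> has norm p^l with l > k, the vector
  \<open>e\<close> with the single entry 1/(p \<zeta>_j) has norm p^(1-l), at most p^(-k), and the
  character takes the value exp(2 pi i / p) at it.\<close>

lemma padic_char_nontrivial:
  fixes \<zeta> :: "'p::prime_card padic ^ 'n"
  assumes "\<zeta> \<notin> padic_ball 0 (- k)"
  obtains e where "e \<in> padic_ball 0 k" "padic_char \<zeta> e \<noteq> 1"
proof -
  note p = prime_card_gt_1[where 'p='p]
  obtain j where j: "padic_norm (\<zeta> $ j) > real CARD('p) powi k"
    using assms by (auto simp: padic_ball_def not_le)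
  then have nz: "\<zeta> $ j \<noteq> 0" using p by (metis less_asym padic_norm_0 zero_less_power_int order_less_trans zero_less_one)
  obtain l where l: "padic_norm (\<zeta> $ j) = real CARD('p) powi l"
    using nz by (rule padic_norm_prime_card_power)
  have "k < l" using j prime_card_powi_mono[of l k, where 'p='p] unfolding l by (cases "k < l") auto
  define e :: "'p padic ^ 'n" where "e = axis j (inverse (of_nat CARD('p) * \<zeta> $ j))"
  have e_nth: "e $ i = (if i = j then inverse (of_nat CARD('p) * \<zeta> $ j) else 0)" for i
    by (simp add: e_def axis_def)
  have "padic_norm (inverse (of_nat CARD('p) * \<zeta> $ j)) = real CARD('p) powi (1 - l)"
    unfolding padic_norm_inverse padic_norm_mult padic_norm_prime l
    using p by (simp add: power_int_diff field_simps)
  also have "\<dots> \<le> real CARD('p) powi (- k)" using \<open>k < l\<close> by (intro prime_card_powi_mono) auto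
  finally have "e \<in> padic_ball 0 k" using p by (simp add: padic_ball_def e_nth)
  moreover have "padic_char \<zeta> e \<noteq> 1"
  proof
    assume *: "padic_char \<zeta> e = 1"
    have "\<zeta> $ i * e $ i = (if i = j then prime_pow (- 1) else 0)" for i
      using nz by (simp add: e_nth power_int_minus)
    then have "(\<Sum>i\<in>UNIV. padic_frac (\<zeta> $ i * e $ i)) = (\<Sum>i\<in>UNIV. if i = j then padic_frac (prime_pow (- 1) :: 'p padic) else 0)"
      by (intro sum.cong) (auto simp: padic_frac_def padic_integers_def)
    then have sum: "(\<Sum>i\<in>UNIV. padic_frac (\<zeta> $ i * e $ i)) = padic_frac (prime_pow (- 1) :: 'p padic)" by simp
    have "padic_norm ((prime_pow (- 1) :: 'p padic) - of_int 1 * prime_pow (- int 1)) \<le> 1" by simp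
    then have "padic_frac_rep (prime_pow (- 1) :: 'p padic) (1 / real CARD('p))"
      unfolding padic_frac_rep_def by (intro exI[of _ 1] conjI) auto
    \<comment> \<open>The fractional part of 1/p is only compared with the real number 1/p modulo
      integers, which is all that the exponential sees.\<close>
    then have "padic_frac (prime_pow (- 1) :: 'p padic) - 1 / real CARD('p) \<in> \<int>"
      by (intro padic_frac_rep_unique[OF padic_frac_rep_padic_frac])
    then have "exp (2 * of_real pi * \<i> * of_real (1 / real CARD('p))) = (1 :: complex)"
      using * unfolding padic_char_def sum by (simp only: exp_2pi_cong)
    then obtain n where n: "2 * pi * (1 / real CARD('p)) = of_int (2 * n) * pi"
      unfolding exp_eq_1 by auto
    then have "1 / real CARD('p) = of_int n" by (simp add: field_simps)
    moreover have "0 < 1 / real CARD('p)" "1 / real CARD('p) < 1" using p by auto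
    ultimately have "0 < n" "n < 1" by simp_all
    then show False by simp
  qed
  ultimately show ?thesis using that by blast
qed

section \<open>Haar measure\<close>

lemma padic_ball_cover:
  fixes x :: "'p::prime_card padic ^ 'n"
  obtains k :: nat where "x \<in> padic_ball 0 (- int k)"
proof -
  define r where "r = Max (range (\<lambda>j. padic_norm (x $ j)))"
  have r: "padic_norm (x $ j) \<le> r" for j
    unfolding r_def by (intro Max_ge) auto
  obtain N where N: "r < real CARD('p) ^ N"
    using real_arch_pow[OF prime_card_gt_1[where 'p='p]] by blast
  have "x \<in> padic_ball 0 (- int N)"
    using order_trans[OF r less_imp_le[OF N]] by (simp add: padic_ball_def)
  then show ?thesis using that by blast
qed

text \<open>Adjoining the empty set makes the family stable under intersection, since two balls are
  nested or disjoint.\<close>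

definition padic_balls :: "('p::prime_card padic ^ 'n) set set" where
  "padic_balls = insert {} (range (\<lambda>(a, k). padic_ball a k))"

lemma padic_ballsI [intro]: "padic_ball a k \<in> padic_balls"
  unfolding padic_balls_def by force

lemma padic_ballsE:
  assumes "B \<in> padic_balls"
  obtains "B = {}" | a k where "B = padic_ball a k"
  using assms unfolding padic_balls_def by auto

lemma Int_stable_padic_balls: "Int_stable padic_balls"
proof (rule Int_stableI)
  fix B C :: "('a padic ^ 'b) set"
  assume B: "B \<in> padic_balls" and C: "C \<in> padic_balls"
  have *: "padic_ball a k \<inter> padic_ball b l \<in> padic_balls" if "k \<le> l" for a b :: "'a padic ^ 'b" and k l
  proof (cases "padic_ball a k \<inter> padic_ball b l = {}")
    case False
    then obtain x where x: "x \<in> padic_ball a k" "x \<in> padic_ball b l" by blast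
    have "padic_ball b l \<subseteq> padic_ball a k"
      using padic_ball_subset[OF that x(1)] padic_ball_eqI[OF x(2)] by simp
    then have "padic_ball a k \<inter> padic_ball b l = padic_ball b l" by blast
    then show ?thesis by auto
  qed (simp add: padic_balls_def)
  show "B \<inter> C \<in> padic_balls"
  proof (cases rule: padic_ballsE[OF B]; cases rule: padic_ballsE[OF C])
    fix a b k l assume "B = padic_ball a k" "C = padic_ball b l"
    then show ?thesis
      using *[of k l a b] *[of l k b a] by (cases "k \<le> l") (auto simp: Int_commute)
  qed (auto simp: padic_balls_def)
qed

text \<open>By density of the rationals every ball has a centre with rational coordinates.\<close>

lemma countable_padic_balls: "countable (padic_balls :: ('p::prime_card padic ^ 'n) set set)"
proof -
  define Q :: "('p padic ^ 'n) set" where "Q = {v. \<forall>j. v $ j \<in> range padic_of_rat}"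
  have Q: "countable Q"
    unfolding Q_def by (intro countable_vector[where B = "\<lambda>_. range padic_of_rat"]) auto
  have "padic_balls \<subseteq> insert {} ((\<lambda>(a, k). padic_ball a k) ` (Q \<times> UNIV))"
  proof
    fix B :: "('p padic ^ 'n) set" assume "B \<in> padic_balls"
    then show "B \<in> insert {} ((\<lambda>(a, k). padic_ball a k) ` (Q \<times> UNIV))"
    proof (cases rule: padic_ballsE)
      case (2 a k)
      have "\<exists>q. padic_norm (a $ j - padic_of_rat q) < real CARD('p) powi (- k)" for j
        by (rule padic_of_rat_approx[of "real CARD('p) powi (- k)" "a $ j"])
          (use prime_card_gt_1[where 'p='p] in auto)
      then obtain q where q: "\<And>j. padic_norm (a $ j - padic_of_rat (q j)) < real CARD('p) powi (- k)"
        by metis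
      define b :: "'p padic ^ 'n" where "b = (\<chi> j. padic_of_rat (q j))"
      have "a \<in> padic_ball b k" using less_imp_le[OF q] by (simp add: padic_ball_def b_def)
      then have "B = padic_ball b k" using 2 padic_ball_eqI by metis
      moreover have "b \<in> Q" by (simp add: Q_def b_def)
      ultimately show ?thesis by auto
    qed simp
  qed
  then show ?thesis by (rule countable_subset) (use Q in auto)
qed

lemma sigma_sets_padic_balls: "sigma_sets UNIV (padic_balls :: ('p::prime_card padic ^ 'n) set set) = sets borel"
proof
  show "sigma_sets UNIV (padic_balls :: ('p padic ^ 'n) set set) \<subseteq> sets borel"
    by (intro sets.sigma_sets_subset[of _ borel, simplified])
      (auto elim!: padic_ballsE intro!: borel_open open_padic_ball)
  have "U \<in> sigma_sets UNIV padic_balls" if U: "open U" for U :: "('p padic ^ 'n) set"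
  proof -
    have "U = \<Union>{B \<in> padic_balls. B \<subseteq> U}"
    proof (intro equalityI subsetI)
      fix x assume "x \<in> U"
      then obtain k :: nat where "padic_ball x (int k) \<subseteq> U"
        by (rule open_contains_padic_ball[OF U])
      then show "x \<in> \<Union>{B \<in> padic_balls. B \<subseteq> U}" by blast
    qed auto
    moreover have "countable {B \<in> padic_balls. B \<subseteq> U}"
      using countable_padic_balls by (rule countable_subset[rotated]) auto
    ultimately show ?thesis
      by (metis (no_types, lifting) sigma_sets_UNION mem_Collect_eq sigma_sets.Basic)
  qed
  then show "sets borel \<subseteq> sigma_sets UNIV (padic_balls :: ('p padic ^ 'n) set set)"
    unfolding borel_def by (subst sets_measure_of) (auto intro!: sigma_sets_mono)
qed

text \<open>The balls are an intersection-stable generator, and the space is exhausted by balls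
  about 0 of finite measure.\<close>

lemma padic_measure_eqI:
  fixes M N :: "('p::prime_card padic ^ 'n) measure"
  assumes sets: "sets M = sets borel" "sets N = sets borel"
    and eq: "\<And>a k. emeasure M (padic_ball a k) = emeasure N (padic_ball a k)"
    and fin: "\<And>k. emeasure M (padic_ball 0 k) \<noteq> \<infinity>"
  shows "M = N"
proof (rule measure_eqI_generator_eq[where A = "\<lambda>i. padic_ball 0 (- int i)", OF Int_stable_padic_balls])
  show "emeasure M X = emeasure N X" if "X \<in> padic_balls" for X
    using that eq by (auto elim: padic_ballsE)
  show "(\<Union>i. padic_ball 0 (- int i)) = (UNIV :: ('p padic ^ 'n) set)"
  proof (intro equalityI subsetI UNIV_I)
    fix x :: "'p padic ^ 'n"
    obtain k :: nat where "x \<in> padic_ball 0 (- int k)" by (rule padic_ball_cover)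
    then show "x \<in> (\<Union>i. padic_ball 0 (- int i))" by blast
  qed
qed (use sets fin in \<open>auto simp: sigma_sets_padic_balls\<close>)

lemma open_padic_iff: "open U \<longleftrightarrow> (\<forall>x\<in>U. \<exists>k. padic_ball x k \<subseteq> U)"
  for U :: "('p::prime_card padic ^ 'n) set"
proof
  assume "open U"
  then show "\<forall>x\<in>U. \<exists>k. padic_ball x k \<subseteq> U" using open_contains_padic_ball by metis
next
  assume *: "\<forall>x\<in>U. \<exists>k. padic_ball x k \<subseteq> U"
  show "open U"
  proof (rule topological_space_class.openI)
    fix x assume "x \<in> U"
    then obtain k where "padic_ball x k \<subseteq> U" using * by blast
    then show "\<exists>T. open T \<and> x \<in> T \<and> T \<subseteq> U" using open_padic_ball padic_ball_self by blast
  qed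
qed

lemma measurable_add_padic [measurable]:
  "(+) c \<in> borel \<rightarrow>\<^sub>M (borel :: ('p::prime_card padic ^ 'n) measure)"
proof -
  have "open ((+) c -` U)" if "open U" for U :: "('p padic ^ 'n) set"
    unfolding open_padic_iff
  proof
    fix x assume "x \<in> (+) c -` U"
    then obtain k where "padic_ball (c + x) k \<subseteq> U"
      using \<open>open U\<close> unfolding open_padic_iff by auto
    then have "padic_ball x k \<subseteq> (+) c -` U" using padic_ball_add_iff[of c _ x k] by blast
    then show "\<exists>k. padic_ball x k \<subseteq> (+) c -` U" by blast
  qed
  then show ?thesis
    by (intro borel_measurableI) (simp add: borel_open)
qed

section \<open>Translation and the masses of balls\<close>

lemma emeasure_distr_add_padic_ball:
  fixes M :: "('p::prime_card padic ^ 'n) measure"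
  assumes "sets M = sets borel"
  shows "emeasure (distr M borel ((+) c)) (padic_ball a k) = emeasure M (padic_ball (a - c) k)"
proof -
  have "(+) c -` padic_ball a k = padic_ball (a - c) k"
    using padic_ball_add_iff[of c _ "a - c" k] by auto
  moreover have "(+) c \<in> borel_measurable M"
    by (subst measurable_cong_sets[OF assms refl]) (rule measurable_add_padic)
  ultimately show ?thesis
    using assms by (subst emeasure_distr) (auto simp: sets_eq_imp_space_eq borel_open open_padic_ball)
qed

text \<open>The hypothesis asks only that balls of equal radius have equal mass, so the recursion
  serves both the constructed measure and any competitor.\<close>

lemma emeasure_padic_ball_step:
  fixes M :: "('p::prime_card padic ^ 'n) measure"
  assumes sets: "sets M = sets borel"
    and inv: "\<And>a k. emeasure M (padic_ball a k) = emeasure M (padic_ball 0 k)"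
  shows "emeasure M (padic_ball 0 k) = of_nat (CARD('p) ^ CARD('n)) * emeasure M (padic_ball 0 (k + 1))"
proof -
  let ?B = "\<lambda>d. padic_ball (subball_center (0 :: 'p padic ^ 'n) k d) (k + 1)"
  have disj: "disjoint_family_on ?B (digit_vecs TYPE('p))"
    using inj_on_subball[of "0 :: 'p padic ^ 'n" k] padic_ball_disjoint
    unfolding disjoint_family_on_def inj_on_def by meson
  have "emeasure M (padic_ball 0 k) = emeasure M (\<Union>d\<in>digit_vecs TYPE('p). ?B d)"
    by (subst padic_ball_subdivide) simp
  also have "\<dots> = (\<Sum>d\<in>digit_vecs TYPE('p). emeasure M (?B d))"
    by (intro sum_emeasure[symmetric] disj finite_digit_vecs) (auto simp: sets borel_open open_padic_ball)
  also have "\<dots> = (\<Sum>d\<in>(digit_vecs TYPE('p) :: ('n \<Rightarrow> nat) set). emeasure M (padic_ball 0 (k + 1)))"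
    by (intro sum.cong refl inv)
  finally show ?thesis by (simp add: card_digit_vecs)
qed

text \<open>Going up, the factor q is cancelled, which in \<open>ennreal\<close> works because it is
  finite and nonzero; going down, the recursion computes the value. This spreads the normalisation
  of one ball to all radii.\<close>

lemma scaled_recursion_unique:
  fixes f g :: "int \<Rightarrow> ennreal"
  assumes f: "\<And>k. f k = of_nat q * f (k + 1)" and g: "\<And>k. g k = of_nat q * g (k + 1)"
    and "f 0 = g 0" "q > 0"
  shows "f k = g k"
proof (induction k rule: int_induct[where k = 0])
  case (step1 k)
  then have "of_nat q * f (k + 1) = of_nat q * g (k + 1)" using f[of k] g[of k] by simp
  then show ?case using \<open>q > 0\<close> by (subst (asm) ennreal_mult_cancel_left) auto
next
  case (step2 k)
  then show ?case using f[of "k - 1"] g[of "k - 1"] by simp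
qed (simp add: assms(3))

section \<open>A content on the compact open sets, obtained by counting balls\<close>

definition compact_opens :: "'a::topological_space set set" where
  "compact_opens = {K. compact K \<and> open K}"

definition ball_count :: "int \<Rightarrow> ('p::prime_card padic ^ 'n) set \<Rightarrow> nat" where
  "ball_count k K = card ((\<lambda>x. padic_ball x k) ` K)"

text \<open>
  On a compact open set the sequence below is eventually constant; on other sets the limit may be a junk value.
\<close>

definition padic_content :: "('p::prime_card padic ^ 'n) set \<Rightarrow> real" where
  "padic_content K = lim (\<lambda>k::nat. real (ball_count (int k) K) * (real CARD('p) ^ CARD('n)) powi (- int k))"

lemma padic_ball_compact_opens: "padic_ball a k \<in> compact_opens"
  by (simp add: compact_opens_def compact_padic_ball open_padic_ball)

text \<open>The small balls centred in \<open>K\<close> are grouped by the large ball that contains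
  them. Different groups are disjoint, and as \<open>K\<close> contains each large ball, every group
  has all p^n members.\<close>

lemma ball_count_step:
  fixes K :: "('p::prime_card padic ^ 'n) set"
  assumes K: "compact K" and sub: "\<And>x. x \<in> K \<Longrightarrow> padic_ball x k \<subseteq> K"
  shows "ball_count (k + 1) K = CARD('p) ^ CARD('n) * ball_count k K"
proof -
  let ?B = "\<lambda>x. padic_ball x k" and ?C = "\<lambda>x. padic_ball x (k + 1)"
  have "?C ` K = (\<Union>B\<in>?B ` K. ?C ` B)"
    using sub by auto
  moreover have "card (\<Union>B\<in>?B ` K. ?C ` B) = (\<Sum>B\<in>?B ` K. card (?C ` B))"
  proof (rule card_UN_disjoint)
    show "finite (?B ` K)" by (rule finite_padic_balls[OF K])
    show "\<forall>B\<in>?B ` K. finite (?C ` B)" by (auto intro: finite_padic_balls compact_padic_ball)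
    show "\<forall>B\<in>?B ` K. \<forall>B'\<in>?B ` K. B \<noteq> B' \<longrightarrow> ?C ` B \<inter> ?C ` B' = {}"
    proof (intro ballI impI)
      fix B B' assume B: "B \<in> ?B ` K" "B' \<in> ?B ` K" "B \<noteq> B'"
      then obtain x y where xy: "B = ?B x" "B' = ?B y" by blast
      have "u \<notin> ?C ` B'" if u: "u \<in> ?C ` B" for u
      proof
        assume "u \<in> ?C ` B'"
        then obtain v w where vw: "v \<in> B" "w \<in> B'" "u = ?C v" "u = ?C w" using u by blast
        \<comment> \<open>Centres sharing a small ball also share a large one, so the two large
          balls could not have been different.\<close>
        then have "v \<in> ?C w" using padic_ball_self by metis
        then have "v \<in> ?B w" using padic_ball_mono[of k "k + 1" w] by auto
        then have "v \<in> B'" using vw(2) padic_ball_trans[of v w k y] unfolding xy by simp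
        then show False using vw(1) padic_ball_disjoint[of x k y] B(3) unfolding xy by auto
      qed
      then show "?C ` B \<inter> ?C ` B' = {}" by blast
    qed
  qed
  moreover have "card (?C ` ?B x) = CARD('p) ^ CARD('n)" for x :: "'p padic ^ 'n"
  proof -
    have "?C ` ?B x = (\<lambda>d. ?C (subball_center x k d)) ` digit_vecs TYPE('p)"
    proof (intro equalityI subsetI)
      fix u assume "u \<in> ?C ` ?B x"
      then obtain y where y: "u = ?C y" "y \<in> ?B x" by blast
      then obtain d where "d \<in> digit_vecs TYPE('p)" "y \<in> ?C (subball_center x k d)"
        by (subst (asm) padic_ball_subdivide) blast
      then show "u \<in> (\<lambda>d. ?C (subball_center x k d)) ` digit_vecs TYPE('p)"
        using y padic_ball_eqI by blast
    next
      fix u assume "u \<in> (\<lambda>d. ?C (subball_center x k d)) ` digit_vecs TYPE('p)"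
      then obtain d where d: "u = ?C (subball_center x k d)" "d \<in> digit_vecs TYPE('p)" by blast
      then have "subball_center x k d \<in> ?B x" by (subst padic_ball_subdivide) auto
      then show "u \<in> ?C ` ?B x" using d by blast
    qed
    then show ?thesis
      using card_image[OF inj_on_subball[of x k]] card_digit_vecs[where 'p='p and 'n='n] by simp
  qed
  then have "(\<Sum>B\<in>?B ` K. card (?C ` B)) = (\<Sum>B\<in>?B ` K. CARD('p) ^ CARD('n))"
    by (intro sum.cong) auto
  ultimately show ?thesis unfolding ball_count_def by simp
qed

text \<open>Once \<open>K\<close> is a union of balls of radius p^(-k), refining multiplies the
  count by p^n and the weight by p^(-n), so the defining sequence is constant from there on.\<close>

lemma padic_content_eq:
  fixes K :: "('p::prime_card padic ^ 'n) set"
  assumes K: "compact K" and sub: "\<And>x. x \<in> K \<Longrightarrow> padic_ball x k \<subseteq> K"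
  shows "padic_content K = real (ball_count k K) * (real CARD('p) ^ CARD('n)) powi (- k)"
proof -
  define q where "q = real CARD('p) ^ CARD('n)"
  have q: "q > 0" using prime_card_gt_1[where 'p='p] by (simp add: q_def)
  have step: "real (ball_count (k + int i) K) * q powi (- (k + int i)) = real (ball_count k K) * q powi (- k)" for i
  proof (induction i)
    case (Suc i)
    have "padic_ball x (k + int i) \<subseteq> K" if "x \<in> K" for x
      using sub[OF that] padic_ball_mono[of k "k + int i" x] by auto
    then have "real (ball_count (k + int i + 1) K) = q * real (ball_count (k + int i) K)"
      using ball_count_step[OF K, of "k + int i"] by (simp add: q_def)
    moreover have "q powi (- (k + int i)) = q * q powi (- (k + int i + 1))"
      using q by (simp add: power_int_diff power_int_minus power_int_add field_simps)
    ultimately have "real (ball_count (k + int i + 1) K) * q powi (- (k + int i + 1))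
        = real (ball_count (k + int i) K) * q powi (- (k + int i))" by (simp only: mult_ac)
    then show ?case using Suc by (simp add: add.assoc add.commute[of 1])
  qed simp
  have "(\<lambda>k::nat. real (ball_count (int k) K) * q powi (- int k)) \<longlonglongrightarrow> real (ball_count k K) * q powi (- k)"
  proof (intro tendsto_eventually eventually_sequentiallyI)
    \<comment> \<open>The sequence runs over natural indices while \<open>k\<close> may be negative,
      hence the threshold \<open>nat k\<close>.\<close>
    fix l assume "nat k \<le> l"
    then have "int l = k + int (nat (int l - k))" by simp
    then show "real (ball_count (int l) K) * q powi (- int l) = real (ball_count k K) * q powi (- k)"
      using step by metis
  qed
  then show ?thesis unfolding padic_content_def q_def by (rule limI)
qed

lemma compact_opens_ball_subset:
  fixes K :: "('p::prime_card padic ^ 'n) set"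
  assumes "K \<in> compact_opens"
  obtains N where "\<And>l x. l \<ge> N \<Longrightarrow> x \<in> K \<Longrightarrow> padic_ball x l \<subseteq> K"
proof (rule compact_padic_ball_uniform[of K "\<lambda>S. S \<subseteq> K"])
  show "\<exists>k. padic_ball x k \<subseteq> K" if "x \<in> K" for x
    using assms open_contains_padic_ball[of K x] that by (auto simp: compact_opens_def)
qed (use assms that in \<open>auto simp: compact_opens_def\<close>)

lemma padic_content_ball:
  "padic_content (padic_ball (a :: 'p::prime_card padic ^ 'n) k) = (real CARD('p) ^ CARD('n)) powi (- k)"
proof -
  have "(\<lambda>x. padic_ball x k) ` padic_ball a k = (\<lambda>_. padic_ball a k) ` padic_ball a k"
    by (rule image_cong[OF refl padic_ball_eqI])
  also have "\<dots> = {padic_ball a k}" using padic_ball_self by blast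
  finally have "ball_count k (padic_ball a k) = 1" by (simp add: ball_count_def)
  then show ?thesis
    using padic_content_eq[OF compact_padic_ball, of a k k] by (simp add: padic_ball_eqI)
qed

lemma padic_content_nonneg:
  fixes K :: "('p::prime_card padic ^ 'n) set"
  assumes "K \<in> compact_opens"
  shows "padic_content K \<ge> 0"
proof -
  obtain N where N: "\<And>l x. l \<ge> N \<Longrightarrow> x \<in> K \<Longrightarrow> padic_ball x l \<subseteq> K"
    using compact_opens_ball_subset[OF assms] by blast
  then have "padic_content K = real (ball_count N K) * (real CARD('p) ^ CARD('n)) powi (- N)"
    using assms by (intro padic_content_eq) (auto simp: compact_opens_def)
  then show ?thesis by simp
qed

lemma padic_content_empty: "padic_content {} = 0"
  by (simp add: padic_content_def ball_count_def)

text \<open>At a radius fine enough for both sets no ball is counted twice, because a shared ball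
  would lie in both of them.\<close>

lemma padic_content_Un:
  fixes K L :: "('p::prime_card padic ^ 'n) set"
  assumes K: "K \<in> compact_opens" and L: "L \<in> compact_opens" and "K \<inter> L = {}"
  shows "padic_content (K \<union> L) = padic_content K + padic_content L"
proof -
  obtain M where M: "\<And>l x. l \<ge> M \<Longrightarrow> x \<in> K \<Longrightarrow> padic_ball x l \<subseteq> K"
    using compact_opens_ball_subset[OF K] by blast
  obtain N where N: "\<And>l x. l \<ge> N \<Longrightarrow> x \<in> L \<Longrightarrow> padic_ball x l \<subseteq> L"
    using compact_opens_ball_subset[OF L] by blast
  define k where "k = max M N"
  have k: "\<And>x. x \<in> K \<Longrightarrow> padic_ball x k \<subseteq> K" "\<And>x. x \<in> L \<Longrightarrow> padic_ball x k \<subseteq> L"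
    "\<And>x. x \<in> K \<union> L \<Longrightarrow> padic_ball x k \<subseteq> K \<union> L"
    using M[of k] N[of k] unfolding k_def by (simp_all, blast)
  have c: "compact K" "compact L" "compact (K \<union> L)"
    using K L by (auto simp: compact_opens_def)
  have "(\<lambda>x. padic_ball x k) ` K \<inter> (\<lambda>x. padic_ball x k) ` L = {}"
  proof (rule ccontr)
    assume "(\<lambda>x. padic_ball x k) ` K \<inter> (\<lambda>x. padic_ball x k) ` L \<noteq> {}"
    then obtain x y where "x \<in> K" "y \<in> L" "padic_ball x k = padic_ball y k" by blast
    then have "x \<in> L" using k(2) padic_ball_self by blast
    then show False using \<open>x \<in> K\<close> assms(3) by blast
  qed
  then have "ball_count k (K \<union> L) = ball_count k K + ball_count k L"
    unfolding ball_count_def image_Un by (intro card_Un_disjoint finite_padic_balls c)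
  then show ?thesis
    using padic_content_eq[OF c(1) k(1)] padic_content_eq[OF c(2) k(2)] padic_content_eq[OF c(3) k(3)]
    by (simp add: distrib_right)
qed

lemma compact_opens_diff:
  assumes "K \<in> compact_opens" "L \<in> compact_opens"
  shows "K - L \<in> (compact_opens :: 'a::t2_space set set)"
  using assms compact_imp_closed[of L] compact_diff[of K L] open_Diff[of K L] by (simp add: compact_opens_def)

lemma ring_of_sets_compact_opens: "ring_of_sets UNIV (compact_opens :: 'a::t2_space set set)"
  by (rule ring_of_setsI) (auto intro: compact_opens_diff, auto simp: compact_opens_def)

lemma padic_content_finite_UN:
  fixes A :: "'i \<Rightarrow> ('p::prime_card padic ^ 'n) set"
  assumes "finite I" "\<And>i. i \<in> I \<Longrightarrow> A i \<in> compact_opens" "disjoint_family_on A I"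
  shows "(\<Union>i\<in>I. A i) \<in> compact_opens \<and> padic_content (\<Union>i\<in>I. A i) = (\<Sum>i\<in>I. padic_content (A i))"
  using assms
proof (induction I)
  case empty
  then show ?case by (simp add: padic_content_empty compact_opens_def)
next
  case (insert i I)
  then have IH: "(\<Union>i\<in>I. A i) \<in> compact_opens" "padic_content (\<Union>i\<in>I. A i) = (\<Sum>i\<in>I. padic_content (A i))"
    by (auto simp: disjoint_family_on_def)
  have "A i \<inter> (\<Union>i\<in>I. A i) = {}"
    using insert.hyps insert.prems(2) by (fastforce simp: disjoint_family_on_def)
  then show ?case
    using padic_content_Un[of "A i" "\<Union>i\<in>I. A i"] IH insert by (auto simp: compact_opens_def)
qed

text \<open>The union is compact and its members are open, so finitely many of them cover it. By
  disjointness all other members are empty and the series is a finite sum.\<close>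

lemma countably_additive_padic_content:
  "countably_additive (compact_opens :: ('p::prime_card padic ^ 'n) set set) (\<lambda>K. ennreal (padic_content K))"
proof (rule countably_additiveI)
  fix A :: "nat \<Rightarrow> ('p padic ^ 'n) set"
  assume A: "range A \<subseteq> compact_opens" "disjoint_family A" "(\<Union>i. A i) \<in> compact_opens"
  have op: "open (A i)" for i using A(1) by (auto simp: compact_opens_def)
  obtain I where I: "finite I" "(\<Union>i. A i) \<subseteq> (\<Union>i\<in>I. A i)"
    using compactE_image[of "\<Union>i. A i" UNIV A] A(3) op by (auto simp: compact_opens_def)
  have emp: "A i = {}" if "i \<notin> I" for i
  proof -
    have "A i \<inter> A j = {}" if "j \<in> I" for j
      using A(2) that \<open>i \<notin> I\<close> unfolding disjoint_family_on_def by (metis UNIV_I)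
    then show ?thesis using I(2) by blast
  qed
  have eq: "(\<Union>i. A i) = (\<Union>i\<in>I. A i)" using I(2) by blast
  have "(\<Sum>i. ennreal (padic_content (A i))) = (\<Sum>i\<in>I. ennreal (padic_content (A i)))"
    using emp by (intro suminf_finite I) (simp add: padic_content_empty)
  also have "\<dots> = ennreal (\<Sum>i\<in>I. padic_content (A i))"
    using A(1) by (intro sum_ennreal padic_content_nonneg) auto
  also have "(\<Sum>i\<in>I. padic_content (A i)) = padic_content (\<Union>i\<in>I. A i)"
  proof (rule padic_content_finite_UN[THEN conjunct2, symmetric])
    show "A i \<in> compact_opens" for i using A(1) by auto
  qed (use I(1) disjoint_family_on_mono[OF subset_UNIV A(2)] in simp_all)
  finally show "(\<Sum>i. ennreal (padic_content (A i))) = ennreal (padic_content (\<Union>i. A i))"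
    unfolding eq .
qed

lemma padic_haar_exists:
  obtains M :: "('p::prime_card padic ^ 'n) measure"
  where "sets M = sets borel"
    "\<And>a k. emeasure M (padic_ball a k) = ennreal ((real CARD('p) ^ CARD('n)) powi (- k))"
proof -
  let ?C = "compact_opens :: ('p padic ^ 'n) set set"
  interpret ring_of_sets UNIV ?C by (rule ring_of_sets_compact_opens)
  have "positive ?C (\<lambda>K. ennreal (padic_content K))"
    by (simp add: positive_def padic_content_empty)
  then obtain \<mu> where \<mu>: "\<forall>K\<in>?C. \<mu> K = ennreal (padic_content K)"
    "measure_space UNIV (sigma_sets UNIV ?C) \<mu>"
    using caratheodory'[OF _ countably_additive_padic_content] by blast
  have borel: "sigma_sets UNIV ?C = sets borel"
  proof
    show "sigma_sets UNIV ?C \<subseteq> sets borel"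
      by (intro sets.sigma_sets_subset[of _ borel, simplified]) (auto simp: compact_opens_def)
    \<comment> \<open>Balls are compact open and already generate the Borel sets, so the
      Caratheodory extension reaches the whole Borel algebra.\<close>
    have "padic_balls \<subseteq> ?C"
      by (auto elim!: padic_ballsE simp: padic_ball_compact_opens)
    then show "sets borel \<subseteq> sigma_sets UNIV ?C"
      unfolding sigma_sets_padic_balls[symmetric] by (rule sigma_sets_mono')
  qed
  define M where "M = measure_of UNIV ?C \<mu>"
  have "sets M = sets borel" unfolding M_def borel[symmetric] by (rule sets_measure_of) simp
  moreover have "emeasure M (padic_ball a k) = ennreal ((real CARD('p) ^ CARD('n)) powi (- k))" for a k
  proof -
    have "emeasure M (padic_ball a k) = \<mu> (padic_ball a k)"
      using \<mu>(2) padic_ball_compact_opens unfolding M_def measure_space_def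
      by (intro emeasure_measure_of[of _ UNIV ?C]) (auto simp: M_def)
    then show ?thesis using \<mu>(1) padic_ball_compact_opens padic_content_ball by metis
  qed
  ultimately show ?thesis using that by blast
qed

text \<open>This resolves the definite description in \<open>haar\<close>: the constructed measure
  satisfies the three conditions, and every solution agrees with it on balls.\<close>

lemma haar_props:
  shows sets_haar [measurable_cong]: "sets (haar :: ('p::prime_card padic ^ 'n) measure) = sets borel"
    and distr_haar: "distr (haar :: ('p::prime_card padic ^ 'n) measure) borel (\<lambda>x. a + x) = haar"
    and emeasure_haar_ball: "emeasure (haar :: ('p::prime_card padic ^ 'n) measure) (padic_ball b k)
           = ennreal ((real CARD('p) ^ CARD('n)) powi (- k))"
proof -
  let ?P = "\<lambda>M :: ('p padic ^ 'n) measure. sets M = sets borel \<and> (\<forall>a. distr M borel (\<lambda>x. a + x) = M) \<and>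
     emeasure M padic_integer_vecs = 1"
  obtain M :: "('p padic ^ 'n) measure" where M: "sets M = sets borel"
    "\<And>a k. emeasure M (padic_ball a k) = ennreal ((real CARD('p) ^ CARD('n)) powi (- k))"
    using padic_haar_exists by blast
  have "distr M borel ((+) c) = M" for c
    using M by (intro padic_measure_eqI) (simp_all add: emeasure_distr_add_padic_ball)
  then have PM: "?P M" using M by (simp add: padic_integer_vecs_eq_ball)
  have uniq: "N = M" if N: "?P N" for N
  proof -
    \<comment> \<open>Translation by \<open>a\<close> itself carries the ball about 0 to the ball
      about \<open>a\<close>.\<close>
    have inv: "emeasure N (padic_ball a k) = emeasure N (padic_ball 0 k)" for a k
      using N emeasure_distr_add_padic_ball[of N a a k] by simp
    have inv': "emeasure M (padic_ball a k) = emeasure M (padic_ball 0 k)" for a k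
      by (simp add: M)
    have "emeasure N (padic_ball 0 k) = emeasure M (padic_ball 0 k)" for k
    proof (rule scaled_recursion_unique)
      show "emeasure N (padic_ball 0 k) = of_nat (CARD('p) ^ CARD('n)) * emeasure N (padic_ball 0 (k + 1))" for k
        using N inv by (intro emeasure_padic_ball_step) blast+
      show "emeasure M (padic_ball 0 k) = of_nat (CARD('p) ^ CARD('n)) * emeasure M (padic_ball 0 (k + 1))" for k
        using M(1) inv' by (intro emeasure_padic_ball_step) blast+
      show "emeasure N (padic_ball 0 0) = emeasure M (padic_ball 0 0)"
        using N PM by (simp add: padic_integer_vecs_eq_ball)
    qed simp
    then have "emeasure M (padic_ball a k) = emeasure N (padic_ball a k)" for a k
      using inv inv' by metis
    then show "N = M" using N M by (intro padic_measure_eqI[symmetric]) auto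
  qed
  have "haar = M" unfolding haar_def using PM uniq by (rule the_equality)
  then show "sets (haar :: ('p padic ^ 'n) measure) = sets borel"
    "distr (haar :: ('p padic ^ 'n) measure) borel (\<lambda>x. a + x) = haar"
    "emeasure (haar :: ('p padic ^ 'n) measure) (padic_ball b k) = ennreal ((real CARD('p) ^ CARD('n)) powi (- k))"
    using PM M by simp_all
qed

section \<open>Fourier inversion\<close>

definition ball_char :: "'p::prime_card padic ^ 'n \<Rightarrow> 'p padic ^ 'n \<Rightarrow> int \<Rightarrow> 'p padic ^ 'n \<Rightarrow> complex" where
  "ball_char \<zeta> b k x = padic_char \<zeta> x * indicator (padic_ball b k) x"

lemma padic_char_cong_ball:
  assumes "\<zeta> \<in> padic_ball 0 (- k)" "y \<in> padic_ball x k"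
  shows "padic_char \<zeta> y = padic_char \<zeta> x"
proof -
  have "padic_char \<zeta> (y - x) = 1"
    using assms padic_ball_iff_diff by (intro padic_char_eq_1[of \<zeta> k]) blast+
  then show ?thesis using padic_char_add_right[of \<zeta> "y - x" x] by simp
qed

lemma padic_char_locally_constant:
  obtains k :: nat where "\<And>x y. y \<in> padic_ball x (int k) \<Longrightarrow> padic_char \<zeta> y = padic_char \<zeta> x"
  using padic_ball_cover[of \<zeta>] padic_char_cong_ball by metis

text \<open>The exponent is uniform in the point: it is the larger of one on whose balls the
  character is constant and the exponent of the cut-off.\<close>

lemma ball_char_locally_constant:
  obtains l where "\<And>x y. y \<in> padic_ball x l \<Longrightarrow> ball_char \<zeta> b k y = ball_char \<zeta> b k x"
proof -
  obtain l :: nat where l: "\<And>x y. y \<in> padic_ball x (int l) \<Longrightarrow> padic_char \<zeta> y = padic_char \<zeta> x"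
    using padic_char_locally_constant[of \<zeta>] by blast
  have "ball_char \<zeta> b k y = ball_char \<zeta> b k x" if y: "y \<in> padic_ball x (max (int l) k)" for x y
  proof -
    have "y \<in> padic_ball x (int l)" "y \<in> padic_ball x k"
      using y padic_ball_mono[of _ "max (int l) k" x] by (meson max.cobounded1 max.cobounded2 subsetD)+
    then have "padic_char \<zeta> y = padic_char \<zeta> x" "y \<in> padic_ball b k \<longleftrightarrow> x \<in> padic_ball b k"
      using l padic_ball_trans padic_ball_sym by blast+
    then show ?thesis by (simp add: ball_char_def indicator_def)
  qed
  then show ?thesis using that by blast
qed

lemma ball_char_measurable: "ball_char \<zeta> b k \<in> borel_measurable borel"
proof (rule borel_measurableI)
  fix V :: "complex set"
  obtain l where l: "\<And>x y. y \<in> padic_ball x l \<Longrightarrow> ball_char \<zeta> b k y = ball_char \<zeta> b k x"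
    using ball_char_locally_constant[of \<zeta> b k] by blast
  have "open (ball_char \<zeta> b k -` V)"
    unfolding open_padic_iff
  proof
    fix x assume "x \<in> ball_char \<zeta> b k -` V"
    then have "padic_ball x l \<subseteq> ball_char \<zeta> b k -` V" using l by fastforce
    then show "\<exists>l. padic_ball x l \<subseteq> ball_char \<zeta> b k -` V" by blast
  qed
  then show "ball_char \<zeta> b k -` V \<inter> space borel \<in> sets borel" by (simp add: borel_open)
qed

lemma integrable_ball_char: "integrable haar (ball_char (\<zeta> :: 'p::prime_card padic ^ 'n) b k)"
proof (rule Bochner_Integration.integrable_bound)
  show "integrable haar (indicator (padic_ball b k) :: 'p padic ^ 'n \<Rightarrow> real)"
    by (intro integrable_real_indicator) (simp_all add: sets_haar borel_open open_padic_ball emeasure_haar_ball)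
  show "ball_char \<zeta> b k \<in> borel_measurable haar"
    using ball_char_measurable by (subst measurable_cong_sets[OF sets_haar refl])
  show "AE x in haar. norm (ball_char \<zeta> b k x) \<le> norm (indicator (padic_ball b k) x :: real)"
    by (simp add: ball_char_def norm_mult indicator_def)
qed

lemma integral_haar_translate:
  fixes f :: "'p::prime_card padic ^ 'n \<Rightarrow> complex"
  assumes "f \<in> borel_measurable borel"
  shows "(LINT x|haar. f (c + x)) = (LINT x|haar. f x)"
proof -
  have "(+) c \<in> measurable (haar :: ('p padic ^ 'n) measure) borel"
    using measurable_add_padic by (subst measurable_cong_sets[OF sets_haar refl])
  then have "(LINT x|distr haar borel ((+) c). f x) = (LINT x|haar. f (c + x))"
    using assms by (rule integral_distr)
  then show ?thesis by (simp add: distr_haar)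
qed

lemma integral_ball_char:
  fixes \<zeta> :: "'p::prime_card padic ^ 'n"
  shows "(LINT x|haar. ball_char \<zeta> b k x) =
    of_real ((real CARD('p) ^ CARD('n)) powi (- k)) * padic_char \<zeta> b * indicator (padic_ball 0 (- k)) \<zeta>"
proof (cases "\<zeta> \<in> padic_ball 0 (- k)")
  case True
  \<comment> \<open>For \<open>\<zeta>\<close> in the dual ball the character is constant on the
    ball about \<open>b\<close>, so the integral is its value at \<open>b\<close> times the
    volume.\<close>
  have "ball_char \<zeta> b k x = padic_char \<zeta> b * of_real (indicator (padic_ball b k) x)" for x
    using padic_char_cong_ball[OF True, of x b] by (auto simp: ball_char_def indicator_def)
  then have "(LINT x|haar. ball_char \<zeta> b k x) = padic_char \<zeta> b * of_real (LINT x|haar. indicator (padic_ball b k) x)"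
    by simp
  also have "(LINT x|haar. indicator (padic_ball b k) x) = measure haar (padic_ball b k)"
    by (simp add: sets_eq_imp_space_eq[OF sets_haar])
  also have "\<dots> = (real CARD('p) ^ CARD('n)) powi (- k)"
    by (simp add: measure_def emeasure_haar_ball)
  finally show ?thesis using True by simp
next
  case False
  then obtain e where e: "e \<in> padic_ball 0 k" "padic_char \<zeta> e \<noteq> 1" by (rule padic_char_nontrivial)
  have "e + b \<in> padic_ball b k" using e(1) by (subst padic_ball_iff_diff) simp
  then have ball: "e + x \<in> padic_ball b k \<longleftrightarrow> x \<in> padic_ball b k" for x
    using padic_ball_eqI[of "e + b" b k] padic_ball_add_iff[of e x b k] by simp
  \<comment> \<open>Translation by \<open>e\<close> preserves the integral but multiplies it by \<open>\<chi>\<^sub>p(\<zeta> \<cdot> e) \<noteq> 1\<close>.\<close>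
  have "ball_char \<zeta> b k (e + x) = padic_char \<zeta> e * ball_char \<zeta> b k x" for x
    using ball[of x] by (simp add: ball_char_def padic_char_add_right indicator_def)
  then have "(LINT x|haar. ball_char \<zeta> b k x) = padic_char \<zeta> e * (LINT x|haar. ball_char \<zeta> b k x)"
    using integral_haar_translate[OF ball_char_measurable, of \<zeta> b k e] by simp
  then have "(LINT x|haar. ball_char \<zeta> b k x) = 0" using e(2) by simp
  then show ?thesis using False by simp
qed

lemma padic_char_mult_ball_char: "padic_char \<xi> x * ball_char \<zeta> b k x = ball_char (\<xi> + \<zeta>) b k x"
  by (simp add: ball_char_def padic_char_add_left)

lemma fourier_cmult: "fourier (\<lambda>x. c * f x) \<xi> = c * fourier f \<xi>"
  by (simp add: fourier_def mult.left_commute[of _ c])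

text \<open>Multiplication by the kernel shifts the frequency to \<xi> + \<zeta>, and the integral
  survives exactly when this sum lies in the dual ball, that is, when \<xi> lies in the ball about
  -\<zeta>.\<close>

lemma fourier_ball_char:
  fixes \<zeta> :: "'p::prime_card padic ^ 'n"
  shows "fourier (ball_char \<zeta> b k) \<xi> =
    of_real ((real CARD('p) ^ CARD('n)) powi (- k)) * padic_char \<zeta> b * ball_char b (- \<zeta>) (- k) \<xi>"
proof -
  have "\<xi> + \<zeta> \<in> padic_ball 0 (- k) \<longleftrightarrow> \<xi> \<in> padic_ball (- \<zeta>) (- k)"
    using padic_ball_iff_diff[of \<xi> "- \<zeta>" "- k"] by simp
  then show ?thesis
    unfolding fourier_def padic_char_mult_ball_char integral_ball_char
    by (simp add: ball_char_def padic_char_add_left padic_char_commute[of b] indicator_def)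
qed

lemma ball_char_minus: "ball_char \<zeta> b k (- x) = ball_char (- \<zeta>) (- b) k x"
  by (simp add: ball_char_def padic_char_minus padic_ball_minus_iff indicator_def)

text \<open>The volume factors of reciprocal balls cancel, and so do the two constant phases.
  Working with \<open>fourier\<close> twice costs only a reflection, which
  \<open>inv_fourier_eq\<close> undoes.\<close>

lemma fourier_fourier_ball_char:
  fixes \<zeta> :: "'p::prime_card padic ^ 'n"
  shows "fourier (fourier (ball_char \<zeta> b k)) x = ball_char \<zeta> b k (- x)"
proof -
  let ?q = "complex_of_real (real CARD('p) ^ CARD('n))"
  have q: "?q powi (- k) * ?q powi k = 1"
    using prime_card_gt_1[where 'p='p] by (simp add: power_int_minus)
  have "fourier (fourier (ball_char \<zeta> b k)) x =
      (?q powi (- k) * ?q powi k) * (padic_char \<zeta> b * padic_char b (- \<zeta>)) * ball_char (- \<zeta>) (- b) k x"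
    unfolding fourier_ball_char fourier_cmult by (simp add: fourier_ball_char mult_ac)
  also have "padic_char \<zeta> b * padic_char b (- \<zeta>) = 1"
    using padic_char_minus_mult(1)[of \<zeta> b] by (simp add: padic_char_commute[of b])
  finally show ?thesis by (simp only: q ball_char_minus mult_1)
qed

lemma fourier_sum_ball_char:
  "fourier (\<lambda>x. \<Sum>i\<in>I. c i * ball_char (\<zeta> i) (b i) (k i) x) \<xi> = (\<Sum>i\<in>I. c i * fourier (ball_char (\<zeta> i) (b i) (k i)) \<xi>)"
proof -
  have "fourier (\<lambda>x. \<Sum>i\<in>I. c i * ball_char (\<zeta> i) (b i) (k i) x) \<xi>
      = (LINT x|haar. (\<Sum>i\<in>I. c i * ball_char (\<xi> + \<zeta> i) (b i) (k i) x))"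
    unfolding fourier_def sum_distrib_left
    by (simp only: mult.left_commute[of "padic_char _ _"] padic_char_mult_ball_char)
  also have "\<dots> = (\<Sum>i\<in>I. (LINT x|haar. c i * ball_char (\<xi> + \<zeta> i) (b i) (k i) x))"
    by (intro Bochner_Integration.integral_sum integrable_mult_right integrable_ball_char)
  finally show ?thesis by (simp add: fourier_def padic_char_mult_ball_char)
qed

section \<open>Inversion for locally constant functions supported in a ball\<close>

lemma locally_constant_on_UNIV_iff:
  "locally_constant_on UNIV f \<longleftrightarrow> (\<forall>x :: 'p::prime_card padic ^ 'n. \<exists>k. \<forall>y\<in>padic_ball x k. f y = f x)"
proof
  assume L: "locally_constant_on UNIV f"
  show "\<forall>x. \<exists>k. \<forall>y\<in>padic_ball x k. f y = f x"
  proof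
    fix x
    obtain U where U: "open U" "x \<in> U" "\<forall>y\<in>U. f y = f x"
      using L unfolding locally_constant_on_def by auto
    obtain k :: nat where "padic_ball x (int k) \<subseteq> U" using U(1,2) by (rule open_contains_padic_ball)
    then show "\<exists>k. \<forall>y\<in>padic_ball x k. f y = f x" using U(3) by blast
  qed
next
  assume R: "\<forall>x. \<exists>k. \<forall>y\<in>padic_ball x k. f y = f x"
  show "locally_constant_on UNIV f"
    unfolding locally_constant_on_def
  proof
    fix x
    obtain k where "\<forall>y\<in>padic_ball x k. f y = f x" using R by blast
    then show "\<exists>U. open U \<and> x \<in> U \<and> (\<forall>y\<in>U \<inter> UNIV. f y = f x)"
      by (intro exI[of _ "padic_ball x k"] conjI open_padic_ball padic_ball_self) (simp only: Int_UNIV_right)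
  qed
qed

text \<open>Compactness makes the radius of constancy uniform on the supporting ball, which then
  splits into finitely many balls of that radius; a cut-off character of frequency 0 is the
  indicator of its ball.\<close>

lemma locally_constant_ball_decomposition:
  fixes f :: "'p::prime_card padic ^ 'n \<Rightarrow> complex"
  assumes f: "locally_constant_on UNIV f" and supp: "\<And>x. x \<notin> padic_ball a k \<Longrightarrow> f x = 0"
  obtains C N where "finite C" "f = (\<lambda>x. \<Sum>c\<in>C. f c * ball_char 0 c N x)"
proof -
  obtain N0 where N0: "\<And>l x. l \<ge> N0 \<Longrightarrow> x \<in> padic_ball a k \<Longrightarrow> \<forall>y\<in>padic_ball x l. \<forall>z\<in>padic_ball x l. f y = f z"
  proof (rule compact_padic_ball_uniform[OF compact_padic_ball, of a k "\<lambda>S. \<forall>y\<in>S. \<forall>z\<in>S. f y = f z"])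
    show "\<exists>l. \<forall>y\<in>padic_ball x l. \<forall>z\<in>padic_ball x l. f y = f z" for x
      using f unfolding locally_constant_on_UNIV_iff by metis
  qed auto
  \<comment> \<open>Taking \<open>N\<close> at least \<open>k\<close> keeps the small balls inside
    the supporting ball, so the sum vanishes outside it.\<close>
  define N where "N = max N0 k"
  have const: "f y = f x" if "x \<in> padic_ball a k" "y \<in> padic_ball x N" for x y
    using N0[of N x] that padic_ball_self[of x N] unfolding N_def by (meson max.cobounded1)
  \<comment> \<open>\<open>C\<close> selects exactly one centre from each small ball, so a point of
    the support meets a single summand.\<close>
  obtain C where C: "C \<subseteq> padic_ball a k" "inj_on (\<lambda>x. padic_ball x N) C"
    "(\<lambda>x. padic_ball x N) ` padic_ball a k = (\<lambda>x. padic_ball x N) ` C"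
    using subset_image_inj[of "(\<lambda>x. padic_ball x N) ` padic_ball a k" "\<lambda>x. padic_ball x N" "padic_ball a k"] by auto
  have fin: "finite C"
    using C(2,3) finite_padic_balls[OF compact_padic_ball, of N a k] finite_imageD by metis
  have "f x = (\<Sum>c\<in>C. f c * ball_char 0 c N x)" for x
  proof (cases "x \<in> padic_ball a k")
    case True
    then obtain c where c: "c \<in> C" "padic_ball x N = padic_ball c N" using C(3) by blast
    have "ball_char 0 d N x = of_bool (d = c)" if "d \<in> C" for d
    proof -
      have "x \<in> padic_ball d N \<longleftrightarrow> padic_ball d N = padic_ball c N"
        using c(2) padic_ball_eqI padic_ball_self by metis
      also have "\<dots> \<longleftrightarrow> d = c" using C(2) c(1) that by (auto dest: inj_onD)
      finally show ?thesis by (simp add: ball_char_def indicator_def)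
    qed
    then have "(\<Sum>d\<in>C. f d * ball_char 0 d N x) = (\<Sum>d\<in>C. if d = c then f d else 0)"
      by (intro sum.cong) auto
    also have "\<dots> = f c" using fin c(1) by simp
    also have "\<dots> = f x"
      using c const[OF True, of c] padic_ball_self by metis
    finally show ?thesis by simp
  next
    case False
    have "ball_char 0 d N x = 0" if "d \<in> C" for d
    proof -
      have "padic_ball d N \<subseteq> padic_ball a k"
        using that C(1) by (intro padic_ball_subset) (auto simp: N_def)
      then show ?thesis using False by (auto simp: ball_char_def indicator_def)
    qed
    then show ?thesis using supp[OF False] by simp
  qed
  then show ?thesis using that[OF fin, of N] by blast
qed

lemma fourier_fourier:
  fixes f :: "'p::prime_card padic ^ 'n \<Rightarrow> complex"
  assumes "locally_constant_on UNIV f" and "\<And>x. x \<notin> padic_ball a k \<Longrightarrow> f x = 0"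
  shows "fourier (fourier f) x = f (- x)"
proof -
  obtain C N where C: "finite C" "f = (\<lambda>x. \<Sum>c\<in>C. f c * ball_char 0 c N x)"
    using locally_constant_ball_decomposition[OF assms] by blast
  let ?q = "complex_of_real ((real CARD('p) ^ CARD('n)) powi (- N))"
  have 1: "fourier f = (\<lambda>\<xi>. \<Sum>c\<in>C. f c * ?q * ball_char c 0 (- N) \<xi>)"
    by (subst C(2)) (simp add: fourier_sum_ball_char fourier_ball_char mult_ac fun_eq_iff)
  have "fourier (fourier f) x = (\<Sum>c\<in>C. f c * (?q * fourier (ball_char c 0 (- N)) x))"
    unfolding 1 fourier_sum_ball_char by (simp add: mult_ac)
  also have "\<dots> = (\<Sum>c\<in>C. f c * fourier (fourier (ball_char 0 c N)) x)"
    by (simp add: fourier_ball_char[abs_def] fourier_cmult)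
  also have "\<dots> = f (- x)"
    unfolding fourier_fourier_ball_char by (subst C(2)) (rule refl)
  finally show ?thesis .
qed

section \<open>Pseudo-differential operators on wavelets\<close>

lemma inv_fourier_eq: "inv_fourier f x = fourier f (- x)"
  by (simp add: inv_fourier_def fourier_def)

lemma ball_char_test_function: "(\<lambda>x. c * ball_char \<zeta> b k x) \<in> test_functions"
proof -
  have "locally_constant_on UNIV (\<lambda>x. c * ball_char \<zeta> b k x)"
    unfolding locally_constant_on_UNIV_iff by (metis ball_char_locally_constant)
  moreover have "closure {x. c * ball_char \<zeta> b k x \<noteq> 0} \<subseteq> padic_ball b k"
    by (intro closure_minimal closed_padic_ball) (auto simp: ball_char_def indicator_def)
  then have "compact (closure {x. c * ball_char \<zeta> b k x \<noteq> 0})"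
    using closed_Int_compact[OF closed_closure compact_padic_ball] by (metis Int_absorb2)
  ultimately show ?thesis by (simp add: test_functions_def)
qed

text \<open>The preimage under the transform is again a cut-off character, now on a ball about
  \<open>\<zeta>\<close>. That ball misses 0 because \<open>\<zeta>\<close> lies outside the ball of
  the same radius about 0.\<close>

lemma ball_char_lizorkin:
  fixes \<zeta> :: "'p::prime_card padic ^ 'n"
  assumes "\<zeta> \<notin> padic_ball 0 (- k)"
  shows "(\<lambda>x. c * ball_char \<zeta> b k x) \<in> lizorkin_functions"
proof -
  let ?q = "complex_of_real (real CARD('p) ^ CARD('n))"
  \<comment> \<open>The factor \<open>d\<close> compensates the volume and the phase that the
    transform of the preimage produces.\<close>
  define d where "d = c * ?q powi (- k) * padic_char \<zeta> b"
  have "0 \<notin> padic_ball \<zeta> (- k)" using assms padic_ball_sym by blast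
  then have "ball_char (- b) \<zeta> (- k) 0 = 0" by (simp add: ball_char_def)
  moreover have "fourier (\<lambda>\<xi>. d * ball_char (- b) \<zeta> (- k) \<xi>) = (\<lambda>x. c * ball_char \<zeta> b k x)"
  proof
    fix x
    have q: "?q powi (- k) * ?q powi k = 1"
      using prime_card_gt_1[where 'p='p] by (simp add: power_int_minus)
    have "fourier (\<lambda>\<xi>. d * ball_char (- b) \<zeta> (- k) \<xi>) x
        = c * (?q powi (- k) * ?q powi k) * (padic_char \<zeta> b * padic_char (- b) \<zeta>) * ball_char \<zeta> b k x"
      unfolding fourier_cmult fourier_ball_char by (simp add: d_def mult_ac)
    also have "padic_char \<zeta> b * padic_char (- b) \<zeta> = 1"
      using padic_char_minus_mult(2)[of \<zeta> b] by (simp add: padic_char_commute[of "- b"])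
    finally show "fourier (\<lambda>\<xi>. d * ball_char (- b) \<zeta> (- k) \<xi>) x = c * ball_char \<zeta> b k x"
      by (simp only: q mult_1_right)
  qed
  ultimately show ?thesis
    unfolding lizorkin_functions_def using ball_char_test_function[of d "- b" \<zeta> "- k"]
    by (metis (mono_tags, lifting) image_eqI mem_Collect_eq mult_zero_right)
qed

text \<open>The transform \<open>g\<close> of \<open>W\<close> is nonzero exactly on the ball about
  -\<zeta>, which avoids the singular point 0 of the symbol. Hence \<open>h\<close>, the symbol
  times \<open>g\<close>, is covered by the inversion formula, the eigenvalue equation becomes h =
  \<mu> g, and \<open>g\<close> can be divided out on the ball.\<close>

lemma pseudo_diff_op_ball_char_eigen_iff:
  fixes A :: "'p::prime_card padic ^ 'n \<Rightarrow> complex" and b :: "'p padic ^ 'n"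
  assumes A: "locally_constant_on (- {0}) A" and \<zeta>: "\<zeta> \<notin> padic_ball 0 (- k)" and c: "c \<noteq> 0"
  defines "W \<equiv> \<lambda>x. c * ball_char \<zeta> b k x"
  shows "pseudo_diff_op A W = (\<lambda>x. \<mu> * W x) \<longleftrightarrow> (\<forall>\<xi>\<in>padic_ball (- \<zeta>) (- k). A \<xi> = \<mu>)"
proof -
  define d where "d = c * of_real ((real CARD('p) ^ CARD('n)) powi (- k)) * padic_char \<zeta> b"
  have d: "d \<noteq> 0" using c prime_card_gt_1[where 'p='p] by (simp add: d_def)
  define g where "g = (\<lambda>\<xi>. d * ball_char b (- \<zeta>) (- k) \<xi>)"
  have g: "fourier W = g"
    unfolding W_def g_def d_def fun_eq_iff fourier_cmult fourier_ball_char by (simp add: mult_ac)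
  have gW: "fourier g x = W (- x)" for x
    unfolding g[symmetric] W_def fourier_cmult[abs_def] fourier_cmult fourier_fourier_ball_char ..
  have g_supp: "g \<xi> = 0" if "\<xi> \<notin> padic_ball (- \<zeta>) (- k)" for \<xi>
    using that by (simp add: g_def ball_char_def)
  have g_nz: "g \<xi> \<noteq> 0" if "\<xi> \<in> padic_ball (- \<zeta>) (- k)" for \<xi>
    using that d by (simp add: g_def ball_char_def)
  have zero: "0 \<notin> padic_ball (- \<zeta>) (- k)"
    using \<zeta> padic_ball_minus_iff[of 0 \<zeta> "- k"] padic_ball_sym[of \<zeta> 0 "- k"] by simp
  define h where "h = (\<lambda>\<xi>. if \<xi> = 0 then 0 else A \<xi> * g \<xi>)"
  have op: "pseudo_diff_op A W = (\<lambda>x. fourier h (- x))"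
    unfolding pseudo_diff_op_def g h_def[symmetric] inv_fourier_eq[abs_def] ..
  have h_supp: "h \<xi> = 0" if "\<xi> \<notin> padic_ball (- \<zeta>) (- k)" for \<xi>
    using g_supp[OF that] by (simp add: h_def)
  \<comment> \<open>Off the ball \<open>h\<close> vanishes on a whole ball of the same radius; on
    the ball the point is nonzero, so the local constancy of the symbol is available.\<close>
  have h_lc: "locally_constant_on UNIV h"
    unfolding locally_constant_on_UNIV_iff
  proof
    fix x
    show "\<exists>l. \<forall>y\<in>padic_ball x l. h y = h x"
    proof (cases "x \<in> padic_ball (- \<zeta>) (- k)")
      case False
      then have "y \<notin> padic_ball (- \<zeta>) (- k)" if "y \<in> padic_ball x (- k)" for y
        using that padic_ball_trans padic_ball_sym by blast
      then show ?thesis using h_supp False by metis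
    next
      case True
      then have "x \<noteq> 0" using zero by auto
      then obtain U where U: "open U" "x \<in> U" "\<And>y. y \<in> U \<Longrightarrow> y \<noteq> 0 \<Longrightarrow> A y = A x"
        using A unfolding locally_constant_on_def by (metis ComplI IntI singletonD)
      \<comment> \<open>Intersecting with the ball about -\<zeta> keeps the neighbourhood away from
        0, where the symbol has no meaning.\<close>
      obtain l1 :: nat where l1: "padic_ball x (int l1) \<subseteq> U \<inter> padic_ball (- \<zeta>) (- k)"
        by (rule open_contains_padic_ball[of "U \<inter> padic_ball (- \<zeta>) (- k)" x])
          (use U(1,2) True in \<open>auto simp: open_padic_ball\<close>)
      obtain l2 where l2: "\<And>y. y \<in> padic_ball x l2 \<Longrightarrow> ball_char b (- \<zeta>) (- k) y = ball_char b (- \<zeta>) (- k) x"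
        using ball_char_locally_constant[of b "- \<zeta>" "- k"] by metis
      have "h y = h x" if "y \<in> padic_ball x (max (int l1) l2)" for y
      proof -
        have "y \<in> padic_ball x (int l1)" "y \<in> padic_ball x l2"
          using that padic_ball_mono[of _ "max (int l1) l2" x] by (meson max.cobounded1 max.cobounded2 subsetD)+
        then have "y \<in> U" "y \<noteq> 0" "g y = g x" using l1 l2[of y] zero by (auto simp: g_def)
        then have "y \<noteq> 0" "A y = A x" "g y = g x" using U(3) by blast+
        then show ?thesis using \<open>x \<noteq> 0\<close> by (simp add: h_def)
      qed
      then show ?thesis by blast
    qed
  qed
  show ?thesis
  proof
    assume "pseudo_diff_op A W = (\<lambda>x. \<mu> * W x)"
    then have "fourier h (- x) = \<mu> * W x" for x unfolding op by metis
    then have "fourier h x = \<mu> * fourier g x" for x using gW[of x] by (metis minus_minus)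
    then have hg: "fourier h = (\<lambda>x. \<mu> * fourier g x)" by blast
    \<comment> \<open>A second transform recovers the reflected functions on both sides, so equality
      of transforms gives equality of \<open>h\<close> and \<mu> g.\<close>
    have "h (- x) = \<mu> * g (- x)" for x
    proof -
      have "h (- x) = fourier (fourier h) x"
        using h_lc h_supp by (rule fourier_fourier[symmetric])
      also have "\<dots> = \<mu> * (d * fourier (fourier (ball_char b (- \<zeta>) (- k))) x)"
        unfolding hg g_def fourier_cmult[abs_def] fourier_cmult ..
      finally show ?thesis by (simp add: fourier_fourier_ball_char g_def)
    qed
    then have hg: "h x = \<mu> * g x" for x by (metis minus_minus)
    show "\<forall>\<xi>\<in>padic_ball (- \<zeta>) (- k). A \<xi> = \<mu>"
    proof
      fix \<xi> assume \<xi>: "\<xi> \<in> padic_ball (- \<zeta>) (- k)"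
      then have "\<xi> \<noteq> 0" using zero by auto
      then show "A \<xi> = \<mu>" using hg[of \<xi>] g_nz[OF \<xi>] by (simp add: h_def)
    qed
  next
    assume *: "\<forall>\<xi>\<in>padic_ball (- \<zeta>) (- k). A \<xi> = \<mu>"
    have "h \<xi> = \<mu> * g \<xi>" for \<xi>
      using * g_supp[of \<xi>] zero by (cases "\<xi> \<in> padic_ball (- \<zeta>) (- k)") (auto simp: h_def)
    then have "h = (\<lambda>\<xi>. \<mu> * g \<xi>)" by blast
    then show "pseudo_diff_op A W = (\<lambda>x. \<mu> * W x)"
      unfolding op by (simp add: fourier_cmult gW)
  qed
qed

section \<open>Wavelets as cut-off characters\<close>

lemma Omega_max_norm: "of_real (Omega (max_norm v)) = (indicator (padic_ball 0 0) v :: complex)"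
proof -
  have "max_norm v \<ge> 0"
    unfolding max_norm_def by (subst Max_ge_iff) auto
  moreover have "max_norm v \<le> 1 \<longleftrightarrow> v \<in> padic_ball 0 0"
    unfolding max_norm_def by (subst Max_le_iff) (auto simp: padic_ball_def)
  ultimately show ?thesis by (simp add: Omega_def indicator_def)
qed

lemma prime_pow_smult_cancel [simp]:
  "(prime_pow k :: 'p::prime_card padic) *s (prime_pow (- k) *s x) = x"
  "(prime_pow (- k) :: 'p::prime_card padic) *s (prime_pow k *s x) = x"
  by (simp_all add: vector_smult_assoc power_int_minus)

text \<open>Factoring p^\<gamma> out of p^\<gamma> x - a turns the cut-off into a ball of radius
  p^\<gamma> about p^(-\<gamma>) a. The phase at -a is constant and joins the normalising factor in
  \<open>c\<close>.\<close>

lemma wavelet_eq_ball_char: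
  fixes s a :: "'p::prime_card padic ^ 'n"
  obtains c where "c \<noteq> 0"
    "wavelet \<gamma> s a = (\<lambda>x. c * ball_char (prime_pow \<gamma> *s s) (prime_pow (- \<gamma>) *s a) (- \<gamma>) x)"
proof
  let ?r = "complex_of_real (real CARD('p) powr (- (real CARD('n) * of_int \<gamma> / 2)))"
  show "?r * padic_char s (- a) \<noteq> 0" using prime_card_gt_1[where 'p='p] by simp
  show "wavelet \<gamma> s a = (\<lambda>x. ?r * padic_char s (- a) *
      ball_char (prime_pow \<gamma> *s s) (prime_pow (- \<gamma>) *s a) (- \<gamma>) x)"
  proof
    fix x
    have "prime_pow \<gamma> *s x - a = prime_pow \<gamma> *s (x - prime_pow (- \<gamma>) *s a)"
      by (simp only: vector_ssub_ldistrib prime_pow_smult_cancel)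
    then have "prime_pow \<gamma> *s x - a \<in> padic_ball 0 0 \<longleftrightarrow> x \<in> padic_ball (prime_pow (- \<gamma>) *s a) (- \<gamma>)"
      by (simp only: padic_ball_prime_pow_iff padic_ball_iff_diff[of x "prime_pow (- \<gamma>) *s a"] diff_0)
    moreover have "padic_char s (prime_pow \<gamma> *s x - a) = padic_char (prime_pow \<gamma> *s s) x * padic_char s (- a)"
      using padic_char_add_right[of s "prime_pow \<gamma> *s x" "- a"] by (simp add: padic_char_scale)
    ultimately show "wavelet \<gamma> s a x = ?r * padic_char s (- a) *
      ball_char (prime_pow \<gamma> *s s) (prime_pow (- \<gamma>) *s a) (- \<gamma>) x"
      by (simp add: wavelet_def Omega_max_norm ball_char_def indicator_def)
  qed
qed

text \<open>Otherwise p^k would divide the integer with digits \<open>d\<close>, so p would divide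
  the leading digit \<open>d 0\<close>, which lies strictly between 0 and p. This is what separates
  the support of the wavelet's transform from 0.\<close>

lemma J_set_norm_gt_1:
  assumes "x \<in> (J_set k :: 'p::prime_card padic set)" "k \<ge> 1"
  shows "padic_norm x > 1"
proof (rule ccontr)
  assume "\<not> padic_norm x > 1"
  obtain d where d: "x = prime_pow (- int k) * (\<Sum>i<k. of_nat (d i) * of_nat CARD('p) ^ i)"
    "\<And>i. i < k \<Longrightarrow> d i < CARD('p)" "d 0 \<noteq> 0"
    using assms(1) unfolding J_set_def by blast
  obtain l where k: "k = Suc l" using assms(2) by (cases k) auto
  define n where "n = (\<Sum>i<k. d i * CARD('p) ^ i)"
  have x: "x = prime_pow (- int k) * of_int (int n)"
    unfolding d(1) n_def by simp
  have "padic_norm x \<le> real CARD('p) powi 0" using \<open>\<not> padic_norm x > 1\<close> by simp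
  then have "padic_norm (of_int (int n) :: 'p padic) \<le> real CARD('p) powi (- int k)"
    unfolding x padic_norm_prime_pow_mult_le_iff by simp
  then have "int CARD('p) ^ k dvd int n" by (simp only: padic_norm_of_int_le_iff)
  then have "CARD('p) ^ k dvd n" by (simp only: of_nat_power[symmetric] of_nat_dvd_iff)
  then have "CARD('p) dvd n" unfolding k by (meson dvd_power dvd_trans zero_less_Suc)
  moreover have "n = d 0 + CARD('p) * (\<Sum>i<l. d (Suc i) * CARD('p) ^ i)"
    unfolding n_def k sum.lessThan_Suc_shift by (simp add: sum_distrib_left mult_ac)
  ultimately have "CARD('p) dvd d 0" by (metis dvd_add_left_iff dvd_triv_left)
  then show False using d(2)[of 0] d(3) k by (auto dest: dvd_imp_le)
qed

theorem theorem6p1: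
  fixes A :: "'p::prime_card padic ^ 'n \<Rightarrow> complex"
    and m :: "'n \<Rightarrow> nat" and \<gamma> :: int and s a :: "'p padic ^ 'n"
  assumes "CARD('n) \<ge> 2"
    and "\<forall>j. m j \<ge> 1"
    and "locally_constant_on (- {0}) A"
    and "s \<in> J_vecs m"
    and "a \<in> I_vecs"
  shows "(eigenfunction (pseudo_diff_op A) (wavelet \<gamma> s a) \<longleftrightarrow>
            (\<forall>\<eta>\<in>padic_integer_vecs. A (prime_pow \<gamma> *s (- s + \<eta>)) = A (- (prime_pow \<gamma> *s s)))) \<and>
         (eigenfunction (pseudo_diff_op A) (wavelet \<gamma> s a) \<longrightarrow>
            pseudo_diff_op A (wavelet \<gamma> s a) =
              (\<lambda>x. A (- (prime_pow \<gamma> *s s)) * wavelet \<gamma> s a x))"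
proof -
  let ?T = "pseudo_diff_op A" and ?W = "wavelet \<gamma> s a"
  define \<zeta> where "\<zeta> = prime_pow \<gamma> *s s"
  define b where "b = prime_pow (- \<gamma>) *s a"
  obtain c where c: "c \<noteq> 0" "?W = (\<lambda>x. c * ball_char \<zeta> b (- \<gamma>) x)"
    unfolding \<zeta>_def b_def by (rule wavelet_eq_ball_char)
  have "padic_norm (s $ j) > 1" for j
    using assms(2,4) by (intro J_set_norm_gt_1[of _ "m j"]) (auto simp: J_vecs_def)
  then have "s \<notin> padic_ball 0 0" by (auto simp: padic_ball_def not_le)
  then have \<zeta>: "\<zeta> \<notin> padic_ball 0 (- (- \<gamma>))"
    by (simp add: \<zeta>_def padic_ball_prime_pow_iff)
  \<comment> \<open>The centre of the ball witnesses that the wavelet is not the zero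
    function.\<close>
  have "?W b \<noteq> 0" using c by (simp add: ball_char_def)
  then have nz: "?W \<noteq> (\<lambda>x. 0)" by metis
  have liz: "?W \<in> lizorkin_functions" unfolding c(2) by (rule ball_char_lizorkin[OF \<zeta>])
  have eig: "?T ?W = (\<lambda>x. \<mu> * ?W x) \<longleftrightarrow> (\<forall>\<xi>\<in>padic_ball (- \<zeta>) \<gamma>. A \<xi> = \<mu>)" for \<mu>
    using pseudo_diff_op_ball_char_eigen_iff[OF assms(3) \<zeta> c(1), of b \<mu>] unfolding c(2) by simp
  \<comment> \<open>The ball supporting the transform is the set of arguments in the stated
    criterion; the integral vector for \<xi> is p^(-\<gamma>) (\<xi> + \<zeta>).\<close>
  have ball: "padic_ball (- \<zeta>) \<gamma> = (\<lambda>\<eta>. prime_pow \<gamma> *s (- s + \<eta>)) ` padic_integer_vecs"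
  proof (intro equalityI subsetI)
    fix \<xi> assume "\<xi> \<in> padic_ball (- \<zeta>) \<gamma>"
    then have "\<xi> + \<zeta> \<in> padic_ball 0 \<gamma>" using padic_ball_iff_diff[of \<xi> "- \<zeta>" \<gamma>] by simp
    then have "prime_pow (- \<gamma>) *s (\<xi> + \<zeta>) \<in> padic_integer_vecs"
      by (simp only: padic_integer_vecs_eq_ball padic_ball_prime_pow_iff) simp
    moreover have "\<xi> = prime_pow \<gamma> *s (- s + prime_pow (- \<gamma>) *s (\<xi> + \<zeta>))"
      by (simp only: vector_add_ldistrib prime_pow_smult_cancel) (simp add: \<zeta>_def)
    ultimately show "\<xi> \<in> (\<lambda>\<eta>. prime_pow \<gamma> *s (- s + \<eta>)) ` padic_integer_vecs" by blast
  next
    fix \<xi> assume "\<xi> \<in> (\<lambda>\<eta>. prime_pow \<gamma> *s (- s + \<eta>)) ` padic_integer_vecs"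
    then obtain \<eta> where "\<eta> \<in> padic_ball 0 0" "\<xi> = - \<zeta> + prime_pow \<gamma> *s \<eta>"
      by (auto simp: padic_integer_vecs_eq_ball \<zeta>_def vector_add_ldistrib)
    then show "\<xi> \<in> padic_ball (- \<zeta>) \<gamma>"
      by (subst padic_ball_iff_diff) (simp add: padic_ball_prime_pow_iff)
  qed
  have "eigenfunction ?T ?W \<longleftrightarrow> (\<exists>\<mu>. \<forall>\<xi>\<in>padic_ball (- \<zeta>) \<gamma>. A \<xi> = \<mu>)"
    unfolding eigenfunction_def eig using liz nz by blast
  \<comment> \<open>The centre -\<zeta> belongs to the ball, so a constant value of the symbol there
    can only be its value at -\<zeta>.\<close>
  also have "\<dots> \<longleftrightarrow> (\<forall>\<xi>\<in>padic_ball (- \<zeta>) \<gamma>. A \<xi> = A (- \<zeta>))"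
  proof
    assume "\<exists>\<mu>. \<forall>\<xi>\<in>padic_ball (- \<zeta>) \<gamma>. A \<xi> = \<mu>"
    then obtain \<mu> where \<mu>: "\<And>\<xi>. \<xi> \<in> padic_ball (- \<zeta>) \<gamma> \<Longrightarrow> A \<xi> = \<mu>" by blast
    show "\<forall>\<xi>\<in>padic_ball (- \<zeta>) \<gamma>. A \<xi> = A (- \<zeta>)"
      by (intro ballI trans[OF \<mu> \<mu>[symmetric]] padic_ball_self)
  qed (rule exI)
  finally have main: "eigenfunction ?T ?W \<longleftrightarrow> (\<forall>\<xi>\<in>padic_ball (- \<zeta>) \<gamma>. A \<xi> = A (- \<zeta>))" .
  have integers: "(\<forall>\<xi>\<in>padic_ball (- \<zeta>) \<gamma>. A \<xi> = A (- \<zeta>)) \<longleftrightarrow>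
      (\<forall>\<eta>\<in>padic_integer_vecs. A (prime_pow \<gamma> *s (- s + \<eta>)) = A (- \<zeta>))"
    unfolding ball by (rule ball_simps)
  show ?thesis
    unfolding \<zeta>_def[symmetric]
  proof (intro conjI impI)
    show "eigenfunction ?T ?W \<longleftrightarrow>
        (\<forall>\<eta>\<in>padic_integer_vecs. A (prime_pow \<gamma> *s (- s + \<eta>)) = A (- \<zeta>))"
      using main integers by (rule trans)
  next
    assume "eigenfunction ?T ?W"
    then show "?T ?W = (\<lambda>x. A (- \<zeta>) * ?W x)" unfolding main eig .
  qed
qed

end
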